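(* Let $G$ be the 1-skeleton of a triangular polyhedron with a realization that admits a flex. Let $\lambda=(\lambda_e)_e$ be the edge lengths induced by the realizations in the flex. Let $\{w_1,w_2\}$ be an edge of $G$ and let $s$ and $n$ be the two opposite vertices of the two triangles (faces) $\{w_1,w_2,s\}$ and $\{w_1,w_2,n\}$ containing $\{w_1,w_2\}$. If the dihedral angle between the faces $\{w_1,w_2,s\}$ and $\{w_1,w_2,n\}$ is not constant along the flex, then there is an induced cycle in $G$ containing the edge $\{w_1,w_2\}$ but neither the vertex $s$ nor the vertex $n$, and there is an assignment of signs $\eta_e\in\{1,-1\}$ to the edges $e$ of this cycle such that $\sum_{e} \eta_e\lambda_e=0$, where the sum runs over the edges $e$ of the cycle.
   Context: A triangular polyhedron is a finite two-dimensional abstract simplicial complex such that every edge belongs to exactly two faces (triangles). Its 1-skeleton is the graph formed by its vertices and edges. Only polyhedra whose 1-skeleton is connected are considered. No further condition (being homeomorphic to a sphere, embedded, or immersed) is imposed. A realization of a triangular polyhedron with 1-skeleton $G=(V,E)$ is a map $\rho\colon V\to\mathbb{R}^3$ such that $\rho(u)\neq\rho(v)$ for every $\{u,v\}\in E$. It induces edge lengths $\lambda_{\{u,v\}}:=\|\rho(u)-\rho(v)\|>0$ for $\{u,v\}\in E$ (Euclidean norm). Two realizations $\rho_1,\rho_2$ are congruent if $\rho_1=\sigma\circ\rho_2$ for some isometry $\sigma$ of $\mathbb{R}^3$. A flex of $G$ with a realization $\rho$ is a continuous map $f\colon[0,1)\to(\mathbb{R}^3)^V$ such that $f(0)=\rho$;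 for every $t\in[0,1)$ the realizations $f(t)$ and $f(0)$ induce the same edge lengths; and for any two distinct $t_1,t_2\in[0,1)$ the realizations $f(t_1)$ and $f(t_2)$ are not congruent. The dihedral angle between two faces sharing an edge is defined only if both realized triangles are non-degenerate (their vertices are not collinear); the hypothesis on the dihedral angle includes that it is defined. A subgraph of $G$ is called induced if it consists of a subset $V'\subseteq V$ and all edges of $G$ having both vertices in $V'$. *)

theory Defs
  imports "HOL-Analysis.Analysis"
begin

text \<open>Simplices are nonempty: the empty simplex is not included in a complex.\<close>

definition abstract_simplicial_complex :: "'a set set \<Rightarrow> bool" where
  "abstract_simplicial_complex K \<longleftrightarrow>
     (\<forall>S\<in>K. finite S \<and> S \<noteq> {}) \<and> (\<forall>S\<in>K. \<forall>T. T \<subseteq> S \<and> T \<noteq> {} \<longrightarrow> T \<in> K)"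

definition two_dimensional :: "'a set set \<Rightarrow> bool" where
  "two_dimensional K \<longleftrightarrow> (\<forall>S\<in>K. card S \<le> 3) \<and> (\<exists>S\<in>K. card S = 3)"

definition vertices :: "'a set set \<Rightarrow> 'a set" where
  "vertices K = {v. {v} \<in> K}"

definition edges :: "'a set set \<Rightarrow> 'a set set" where
  "edges K = {e \<in> K. card e = 2}"

definition faces :: "'a set set \<Rightarrow> 'a set set" where
  "faces K = {F \<in> K. card F = 3}"

text \<open>A finite simple graph is given by its vertex set \<open>V\<close> and its set \<open>E\<close> of two-element
  edges; the 1-skeleton of \<open>K\<close> is \<open>(vertices K, edges K)\<close>.\<close>

definition connected_graph :: "'a set \<Rightarrow> 'a set set \<Rightarrow> bool" where
  "connected_graph V E \<longleftrightarrow>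
     V \<noteq> {} \<and> (\<forall>u\<in>V. \<forall>v\<in>V. (u, v) \<in> {(x, y). {x, y} \<in> E}\<^sup>*)"

definition triangular_polyhedron :: "'a set set \<Rightarrow> bool" where
  "triangular_polyhedron K \<longleftrightarrow>
     finite K \<and> abstract_simplicial_complex K \<and> two_dimensional K \<and>
     (\<forall>e\<in>edges K. card {F \<in> faces K. e \<subseteq> F} = 2) \<and>
     connected_graph (vertices K) (edges K)"

text \<open>A map \<open>V \<Rightarrow> \<real>\<^sup>3\<close> is represented by a total function whose values outside \<open>V\<close> are
  irrelevant; every notion below only inspects the values on \<open>V\<close>.\<close>

definition realization :: "'a set \<Rightarrow> 'a set set \<Rightarrow> ('a \<Rightarrow> real^3) \<Rightarrow> bool" where
  "realization V E \<rho> \<longleftrightarrow> (\<forall>u\<in>V. \<forall>v\<in>V. {u, v} \<in> E \<longrightarrow> \<rho> u \<noteq> \<rho> v)"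

definition edge_length :: "('a \<Rightarrow> real^3) \<Rightarrow> 'a set \<Rightarrow> real" where
  "edge_length \<rho> e = (THE l. \<exists>u v. e = {u, v} \<and> l = norm (\<rho> u - \<rho> v))"

lemma edge_length_pair: "edge_length \<rho> {u, v} = norm (\<rho> u - \<rho> v)"
  unfolding edge_length_def
  by (rule the_equality) (auto simp: doubleton_eq_iff norm_minus_commute)

definition congruent_realizations ::
    "'a set \<Rightarrow> ('a \<Rightarrow> real^3) \<Rightarrow> ('a \<Rightarrow> real^3) \<Rightarrow> bool" where
  "congruent_realizations V \<rho>\<^sub>1 \<rho>\<^sub>2 \<longleftrightarrow>
     (\<exists>\<sigma> :: real^3 \<Rightarrow> real^3. (\<forall>x y. dist (\<sigma> x) (\<sigma> y) = dist x y) \<and> (\<forall>v\<in>V. \<rho>\<^sub>1 v = \<sigma> (\<rho>\<^sub>2 v)))"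

text \<open>Continuity into the finite power \<open>(\<real>\<^sup>3)\<^sup>V\<close> is continuity of every component.\<close>

definition is_flex ::
    "'a set \<Rightarrow> 'a set set \<Rightarrow> ('a \<Rightarrow> real^3) \<Rightarrow> (real \<Rightarrow> 'a \<Rightarrow> real^3) \<Rightarrow> bool" where
  "is_flex V E \<rho> f \<longleftrightarrow>
     (\<forall>v\<in>V. continuous_on {0..<1} (\<lambda>t. f t v)) \<and>
     (\<forall>v\<in>V. f 0 v = \<rho> v) \<and>
     (\<forall>t\<in>{0..<1}. \<forall>e\<in>E. edge_length (f t) e = edge_length (f 0) e) \<and>
     (\<forall>t\<^sub>1\<in>{0..<1}. \<forall>t\<^sub>2\<in>{0..<1}. t\<^sub>1 \<noteq> t\<^sub>2 \<longrightarrow> \<not> congruent_realizations V (f t\<^sub>1) (f t\<^sub>2))"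

text \<open>The component of \<open>x\<close> orthogonal to \<open>d\<close>.\<close>

definition orth_part :: "real^3 \<Rightarrow> real^3 \<Rightarrow> real^3" where
  "orth_part d x = x - ((x \<bullet> d) / (d \<bullet> d)) *\<^sub>R d"

definition vector_angle :: "real^3 \<Rightarrow> real^3 \<Rightarrow> real" where
  "vector_angle x y = arccos ((x \<bullet> y) / (norm x * norm y))"

text \<open>The angle, in \<open>[0, \<pi>]\<close>, between the half-planes that are bounded by the line through
  \<open>p\<close> and \<open>q\<close> and contain \<open>a\<close> and \<open>b\<close>, respectively.  It is meaningful only
  if neither \<open>p, q, a\<close> nor \<open>p, q, b\<close> are collinear.\<close>

definition dihedral_angle :: "real^3 \<Rightarrow> real^3 \<Rightarrow> real^3 \<Rightarrow> real^3 \<Rightarrow> real" where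
  "dihedral_angle p q a b =
     vector_angle (orth_part (q - p) (a - p)) (orth_part (q - p) (b - p))"

definition dihedral_angle_defined :: "real^3 \<Rightarrow> real^3 \<Rightarrow> real^3 \<Rightarrow> real^3 \<Rightarrow> bool" where
  "dihedral_angle_defined p q a b \<longleftrightarrow> \<not> collinear {p, q, a} \<and> \<not> collinear {p, q, b}"

definition cycle_graph :: "'a set \<Rightarrow> 'a set set \<Rightarrow> bool" where
  "cycle_graph C D \<longleftrightarrow>
     (\<exists>vs. distinct vs \<and> length vs \<ge> 3 \<and> C = set vs \<and>
           D = {{vs ! i, vs ! (Suc i mod length vs)} | i. i < length vs})"

definition induced_subgraph :: "'a set \<Rightarrow> 'a set set \<Rightarrow> 'a set \<Rightarrow> 'a set set \<Rightarrow> bool" where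
  "induced_subgraph C D V E \<longleftrightarrow> C \<subseteq> V \<and> D = {e \<in> E. e \<subseteq> C}"

definition induced_cycle :: "'a set \<Rightarrow> 'a set set \<Rightarrow> 'a set \<Rightarrow> 'a set set \<Rightarrow> bool" where
  "induced_cycle C D V E \<longleftrightarrow> induced_subgraph C D V E \<and> cycle_graph C D"

end

theory Submission
  imports Defs
begin

text \<open>
  Suppose the dihedral angle at the edge \<open>{w\<^sub>1, w\<^sub>2}\<close> varies.  In coordinates that move with the
  triangle \<open>{w\<^sub>1, w\<^sub>2, s}\<close> the vertices \<open>w\<^sub>1\<close>, \<open>w\<^sub>2\<close>, \<open>s\<close> are at rest while the vertex \<open>n\<close> runs
  through infinitely many points of a circle around the line \<open>w\<^sub>1 w\<^sub>2\<close>, and all edges keep their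
  lengths.  Over the complex numbers a circle is unbounded, so the algebraic curve traced out by
  the flex contains points where \<open>n\<close> escapes to infinity.  The zero-sum cycle is read off from the
  limit at such a point.

  The limit is taken with a valuation instead of algebraic geometry.  Choose a sequence of times at
  which the height \<open>y(n)\<close> of \<open>n\<close> takes pairwise distinct values.  In an ultrapower of the reals,
  the class \<open>Y(n)\<close> of this sequence is transcendental over the reals, and therefore (lemma
  \<open>valuation_ring_avoiding\<close>) some valuation ring \<open>R\<close> contains all reals but not \<open>Y(n)\<close>.  Call the
  elements of \<open>R\<close> finite and its non-units infinitesimal.  The vertex \<open>n\<close> is now at infinity, and
  since \<open>Y(n)\<^sup>2 + Z(n)\<^sup>2\<close> is real, \<open>j = Z(n) / Y(n)\<close> is finite with \<open>j\<^sup>2\<close> infinitely close to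
  \<open>-1\<close>: the vertex \<open>n\<close> tends to infinity in the isotropic direction \<open>(0, 1, j)\<close>.

  Let \<open>A\<close> be the set of vertices at finite points that are infinitely close to the isotropic plane
  \<open>Y + j Z = 0\<close>, and \<open>B\<close> the set of vertices that are at infinity in the direction \<open>(0, 1, j)\<close>.
  A face with a vertex in \<open>A\<close> and a vertex in \<open>B\<close> has its third vertex in \<open>A\<close> or \<open>B\<close>: a finite third
  vertex lies on the plane, because it and the vertex in \<open>A\<close> both have finite distance to the same
  point at infinity (\<open>finite_neighbour_on_plane\<close>), and a third vertex at infinity shares the direction, because
  mutually orthogonal isotropic directions in three-space are equal (\<open>infinite_neighbour_towards\<close>).
  So the faces that meet both \<open>A\<close> and \<open>B\<close> form closed strips of triangles, one of which passes
  through \<open>{w\<^sub>1, w\<^sub>2, n}\<close>.  Its boundary on the side of \<open>A\<close> uses the edge \<open>{w\<^sub>1, w\<^sub>2}\<close> only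
  once, because \<open>s\<close> is at rest and hence not in \<open>B\<close>; so \<open>w\<^sub>1\<close> and \<open>w\<^sub>2\<close> are joined inside \<open>A\<close> by a
  path that avoids this edge (\<open>path_along_mixed_strip\<close>).  A shortest such path closes up to an
  induced cycle.  It avoids \<open>n\<close>, which is not finite, and \<open>s\<close>, which is finite but off the plane as
  the triangle \<open>{w\<^sub>1, w\<^sub>2, s}\<close> is not degenerate.

  Finally, the Euclidean form is degenerate on an isotropic plane: the square of the length of a vector
  is infinitely close to the square of its first coordinate.  Along an edge of the cycle the first
  coordinate therefore changes by plus or minus the length, up to an infinitesimal
  (\<open>edge_on_plane_signed_length\<close>).  These changes add up to zero around the cycle, so the signed
  sum of the lengths is an infinitesimal real number, that is, zero.
\<close>

section \<open>An ultrapower of the reals\<close>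

text \<open>A family with this strong form of the finite intersection property that is maximal is a free
  ultrafilter; infinite rather than nonempty intersections make it free.\<close>

definition fip_infinite :: "nat set set \<Rightarrow> bool" where
  "fip_infinite M \<longleftrightarrow> (\<forall>S. finite S \<longrightarrow> S \<subseteq> M \<longrightarrow> infinite (\<Inter>S))"

definition free_ultrafilter :: "nat set set \<Rightarrow> bool" where
  "free_ultrafilter M \<longleftrightarrow>
     (\<forall>X\<in>M. infinite X) \<and> (\<forall>X\<in>M. \<forall>Y\<in>M. X \<inter> Y \<in> M) \<and> (\<forall>X. X \<in> M \<or> - X \<in> M)"

lemma free_ultrafilter_exists: "\<exists>M. free_ultrafilter M"
proof -
  have "\<exists>M\<in>Collect fip_infinite. \<forall>X\<in>Collect fip_infinite. M \<subseteq> X \<longrightarrow> X = M"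
  proof (rule subset_Zorn_nonempty)
    have "fip_infinite {}" by (simp add: fip_infinite_def)
    then show "Collect fip_infinite \<noteq> {}" by blast
    fix C assume C: "C \<noteq> {}" "subset.chain (Collect fip_infinite) C"
    show "\<Union>C \<in> Collect fip_infinite"
      unfolding mem_Collect_eq fip_infinite_def
    proof (intro allI impI)
      fix S assume S: "finite S" "S \<subseteq> \<Union>C"
      obtain M where "M \<in> C" "S \<subseteq> M"
        by (rule finite_subset_Union_chain[OF S C])
      then show "infinite (\<Inter>S)"
        using C(2) S(1) by (auto simp: subset_chain_def fip_infinite_def)
    qed
  qed
  then obtain M where M: "fip_infinite M"
    and max: "\<And>X. fip_infinite X \<Longrightarrow> M \<subseteq> X \<Longrightarrow> X = M"
    by blast
  \<comment> \<open>By maximality, a set that can be added without harm already belongs to the family.\<close>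
  have mem: "X \<in> M" if "\<And>S. finite S \<Longrightarrow> S \<subseteq> M \<Longrightarrow> infinite (\<Inter>S \<inter> X)" for X
  proof -
    have "fip_infinite (insert X M)"
      unfolding fip_infinite_def
    proof (intro allI impI)
      fix S assume S: "finite S" "S \<subseteq> insert X M"
      then have "infinite (\<Inter>(S - {X}) \<inter> X)"
        by (intro that) auto
      moreover have "\<Inter>(S - {X}) \<inter> X \<subseteq> \<Inter>S" by auto
      ultimately show "infinite (\<Inter>S)" using finite_subset by blast
    qed
    from max[OF this] show ?thesis by blast
  qed
  have inf: "infinite (\<Inter>S)" if "finite S" "S \<subseteq> M" for S
    using M that by (simp add: fip_infinite_def)
  have "infinite X" if "X \<in> M" for X
    using inf[of "{X}"] that by simp
  moreover have "X \<inter> Y \<in> M" if "X \<in> M" "Y \<in> M" for X Y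
  proof (rule mem)
    fix S assume "finite S" "S \<subseteq> M"
    then have "infinite (\<Inter>(insert X (insert Y S)))" using that by (intro inf) auto
    then show "infinite (\<Inter>S \<inter> (X \<inter> Y))" by (simp add: Int_ac)
  qed
  moreover have "X \<in> M \<or> - X \<in> M" for X
  proof (rule ccontr)
    assume "\<not> (X \<in> M \<or> - X \<in> M)"
    then have "X \<notin> M" "- X \<notin> M" by auto
    obtain S where S: "finite S" "S \<subseteq> M" "finite (\<Inter>S \<inter> X)"
      using mem[of X] \<open>X \<notin> M\<close> by metis
    obtain T where T: "finite T" "T \<subseteq> M" "finite (\<Inter>T \<inter> - X)"
      using mem[of "- X"] \<open>- X \<notin> M\<close> by metis
    have "\<Inter>(S \<union> T) \<subseteq> (\<Inter>S \<inter> X) \<union> (\<Inter>T \<inter> - X)" by auto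
    then have "finite (\<Inter>(S \<union> T))" using S(3) T(3) by (meson finite_UnI finite_subset)
    then show False using inf[of "S \<union> T"] S T by simp
  qed
  ultimately have "free_ultrafilter M" by (simp add: free_ultrafilter_def)
  then show ?thesis ..
qed

definition ultra :: "nat set set" where
  "ultra = (SOME M. free_ultrafilter M)"

lemma free_ultrafilter_ultra: "free_ultrafilter ultra"
  unfolding ultra_def by (rule someI_ex[OF free_ultrafilter_exists])

definition almost_all :: "(nat \<Rightarrow> bool) \<Rightarrow> bool" where
  "almost_all P \<longleftrightarrow> {k. P k} \<in> ultra"

lemma almost_all_conj:
  assumes "almost_all P" "almost_all Q"
  shows "almost_all (\<lambda>k. P k \<and> Q k)"
proof -
  have "{k. P k} \<inter> {k. Q k} \<in> ultra"
    using assms free_ultrafilter_ultra by (simp add: almost_all_def free_ultrafilter_def)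
  then show ?thesis by (simp add: almost_all_def Collect_conj_eq)
qed

lemma almost_all_not: "almost_all (\<lambda>k. \<not> P k)" if "\<not> almost_all P"
proof -
  have "- {k. P k} \<in> ultra"
    using that free_ultrafilter_ultra unfolding almost_all_def free_ultrafilter_def by blast
  then show ?thesis by (simp add: almost_all_def Collect_neg_eq)
qed

lemma almost_all_infinite: "almost_all P \<Longrightarrow> infinite {k. P k}"
  using free_ultrafilter_ultra by (simp add: almost_all_def free_ultrafilter_def)

lemma almost_all_mono:
  assumes "almost_all P" "\<And>k. P k \<Longrightarrow> Q k"
  shows "almost_all Q"
proof (rule ccontr)
  assume "\<not> almost_all Q"
  then have "almost_all (\<lambda>k. P k \<and> \<not> Q k)"
    using assms(1) by (intro almost_all_conj almost_all_not)
  then have "infinite {k. P k \<and> \<not> Q k}" by (rule almost_all_infinite)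
  moreover have "{k. P k \<and> \<not> Q k} = {}" using assms(2) by blast
  ultimately show False by simp
qed

lemma almost_all_const [simp]: "almost_all (\<lambda>k. c) \<longleftrightarrow> c"
  using almost_all_infinite[of "\<lambda>k. c"] almost_all_not[of "\<lambda>k. c"]
    almost_all_infinite[of "\<lambda>k. \<not> c"] by (cases c) auto

text \<open>Only three properties of this field matter: it contains the reals, identities that hold along
  a sequence of reals hold for the classes of the sequences, and it has elements that are
  transcendental over the reals.\<close>

quotient_type ultrareal = "nat \<Rightarrow> real" / "\<lambda>f g. almost_all (\<lambda>k. f k = g k)"
proof (intro equivpI reflpI sympI transpI)
  show "almost_all (\<lambda>k. f k = f k)" for f :: "nat \<Rightarrow> real" by simp
  show "almost_all (\<lambda>k. g k = f k)" if "almost_all (\<lambda>k. f k = g k)" for f g :: "nat \<Rightarrow> real"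
    using that by (rule almost_all_mono) simp
  show "almost_all (\<lambda>k. f k = h k)"
    if "almost_all (\<lambda>k. f k = g k)" "almost_all (\<lambda>k. g k = h k)" for f g h :: "nat \<Rightarrow> real"
    using almost_all_conj[OF that] by (rule almost_all_mono) simp
qed

instantiation ultrareal :: "{zero, one, plus, minus, uminus, times, inverse, scaleR}"
begin

lift_definition zero_ultrareal :: ultrareal is "\<lambda>k. 0" .
lift_definition one_ultrareal :: ultrareal is "\<lambda>k. 1" .
lift_definition plus_ultrareal :: "ultrareal \<Rightarrow> ultrareal \<Rightarrow> ultrareal" is "\<lambda>f g k. f k + g k"
  by (drule (1) almost_all_conj) (erule almost_all_mono, simp)
lift_definition minus_ultrareal :: "ultrareal \<Rightarrow> ultrareal \<Rightarrow> ultrareal" is "\<lambda>f g k. f k - g k"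
  by (drule (1) almost_all_conj) (erule almost_all_mono, simp)
lift_definition times_ultrareal :: "ultrareal \<Rightarrow> ultrareal \<Rightarrow> ultrareal" is "\<lambda>f g k. f k * g k"
  by (drule (1) almost_all_conj) (erule almost_all_mono, simp)
lift_definition divide_ultrareal :: "ultrareal \<Rightarrow> ultrareal \<Rightarrow> ultrareal" is "\<lambda>f g k. f k / g k"
  by (drule (1) almost_all_conj) (erule almost_all_mono, simp)
lift_definition uminus_ultrareal :: "ultrareal \<Rightarrow> ultrareal" is "\<lambda>f k. - f k"
  by (erule almost_all_mono) simp
lift_definition inverse_ultrareal :: "ultrareal \<Rightarrow> ultrareal" is "\<lambda>f k. inverse (f k)"
  by (erule almost_all_mono) simp
lift_definition scaleR_ultrareal :: "real \<Rightarrow> ultrareal \<Rightarrow> ultrareal" is "\<lambda>r f k. r * f k"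
  by (erule almost_all_mono) simp

instance ..

end

instance ultrareal :: real_field
proof
  fix a b c :: ultrareal and r t :: real
  show "a + b + c = a + (b + c)" by transfer (simp add: algebra_simps)
  show "a + b = b + a" by transfer (simp add: algebra_simps)
  show "0 + a = a" by transfer simp
  show "- a + a = 0" by transfer simp
  show "a - b = a + - b" by transfer simp
  show "a * b * c = a * (b * c)" by transfer (simp add: algebra_simps)
  show "a * b = b * a" by transfer (simp add: algebra_simps)
  show "1 * a = a" by transfer simp
  show "(a + b) * c = a * c + b * c" by transfer (simp add: algebra_simps)
  show "(0::ultrareal) \<noteq> 1" by transfer simp
  show "inverse (0::ultrareal) = 0" by transfer simp
  show "a / b = a * inverse b" by transfer (simp add: field_simps)
  show "inverse a * a = 1" if "a \<noteq> 0"
    using that by transfer (drule almost_all_not, erule almost_all_mono, simp)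
  show "a * 1 = a" by transfer simp
  show "a * (b + c) = a * b + a * c" by transfer (simp add: algebra_simps)
  show "a * inverse a = 1" if "a \<noteq> 0"
    using that by transfer (drule almost_all_not, erule almost_all_mono, simp)
  show "r *\<^sub>R (a + b) = r *\<^sub>R a + r *\<^sub>R b" by transfer (simp add: algebra_simps)
  show "(r + t) *\<^sub>R a = r *\<^sub>R a + t *\<^sub>R a" by transfer (simp add: algebra_simps)
  show "r *\<^sub>R t *\<^sub>R a = (r * t) *\<^sub>R a" by transfer (simp add: algebra_simps)
  show "1 *\<^sub>R a = a" by transfer simp
  show "r *\<^sub>R a * b = r *\<^sub>R (a * b)" by transfer (simp add: algebra_simps)
  show "a * r *\<^sub>R b = r *\<^sub>R (a * b)" by transfer (simp add: algebra_simps)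
qed

lift_definition seq_class :: "(nat \<Rightarrow> real) \<Rightarrow> ultrareal" is "\<lambda>f. f" .

lemma seq_class_ring:
  "seq_class (\<lambda>k. f k + g k) = seq_class f + seq_class g"
  "seq_class (\<lambda>k. f k - g k) = seq_class f - seq_class g"
  "seq_class (\<lambda>k. f k * g k) = seq_class f * seq_class g"
  by (transfer, simp)+

lemma seq_class_inverse: "seq_class (\<lambda>k. inverse (f k)) = inverse (seq_class f)"
  by transfer simp

lemma seq_class_const: "seq_class (\<lambda>k. c) = of_real c"
  unfolding of_real_def by transfer simp

lemma seq_class_power: "seq_class (\<lambda>k. f k ^ n) = seq_class f ^ n"
  by (induction n) (simp_all add: seq_class_ring seq_class_const)

lemma seq_class_poly: "seq_class (\<lambda>k. poly p (f k)) = poly (map_poly of_real p) (seq_class f)"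
  by (induction p) (simp_all add: seq_class_ring seq_class_const map_poly_pCons)

text \<open>An injective sequence meets the finitely many roots of a polynomial only finitely often, and a free
  ultrafilter contains no finite set.\<close>

lemma seq_class_transcendental:
  assumes "inj f" "p \<noteq> 0"
  shows "poly (map_poly of_real p) (seq_class f) \<noteq> 0"
proof
  assume "poly (map_poly of_real p) (seq_class f) = 0"
  then have "seq_class (\<lambda>k. poly p (f k)) = 0" by (simp add: seq_class_poly)
  then have "almost_all (\<lambda>k. poly p (f k) = 0)" by transfer
  then have "infinite {k. f k \<in> {x. poly p x = 0}}" by (simp add: almost_all_infinite)
  moreover have "finite {k. f k \<in> {x. poly p x = 0}}"
    using finite_vimageI[OF poly_roots_finite[OF assms(2)] assms(1)] by (simp add: vimage_def)
  ultimately show False by contradiction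
qed

section \<open>Existence of valuation rings\<close>

definition subring :: "'a::field set \<Rightarrow> bool" where
  "subring R \<longleftrightarrow> 1 \<in> R \<and> (\<forall>x\<in>R. \<forall>y\<in>R. x - y \<in> R \<and> x * y \<in> R)"

definition valuation_ring :: "'a::field set \<Rightarrow> bool" where
  "valuation_ring R \<longleftrightarrow> subring R \<and> (\<forall>x. x \<in> R \<or> inverse x \<in> R)"

lemma subring_closed:
  assumes "subring R"
  shows "1 \<in> R" "0 \<in> R" "x \<in> R \<Longrightarrow> - x \<in> R"
    and "x \<in> R \<Longrightarrow> y \<in> R \<Longrightarrow> x - y \<in> R"
    and "x \<in> R \<Longrightarrow> y \<in> R \<Longrightarrow> x + y \<in> R"
    and "x \<in> R \<Longrightarrow> y \<in> R \<Longrightarrow> x * y \<in> R"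
proof -
  show diff: "x - y \<in> R" and "x * y \<in> R" if "x \<in> R" "y \<in> R" for x y
    using assms that by (auto simp: subring_def)
  show 1: "1 \<in> R" using assms by (simp add: subring_def)
  show 0: "0 \<in> R" using diff[OF 1 1] by simp
  show neg: "- x \<in> R" if "x \<in> R" for x using diff[OF 0 that] by simp
  show "x + y \<in> R" if "x \<in> R" "y \<in> R" using diff[OF that(1) neg[OF that(2)]] by simp
qed

lemma subring_power: "subring R \<Longrightarrow> x \<in> R \<Longrightarrow> x ^ k \<in> R"
  by (induction k) (auto intro: subring_closed)

lemma subring_sum: "subring R \<Longrightarrow> (\<And>i. i \<in> I \<Longrightarrow> h i \<in> R) \<Longrightarrow> sum h I \<in> R"
  by (induction I rule: infinite_finite_induct) (auto intro: subring_closed)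

definition adjoin :: "'a::field set \<Rightarrow> 'a \<Rightarrow> 'a set" where
  "adjoin R x = {poly p x | p. \<forall>i. coeff p i \<in> R}"

lemma poly_in_subring:
  assumes "subring R" "\<And>i. coeff p i \<in> R" "x \<in> R"
  shows "poly p x \<in> R"
  unfolding poly_altdef using assms by (intro subring_sum) (auto intro: subring_closed subring_power)

lemma subring_adjoin:
  assumes R: "subring R"
  shows "subring (adjoin R x)"
  unfolding subring_def
proof (intro conjI ballI)
  show "1 \<in> adjoin R x"
    unfolding adjoin_def using subring_closed(1,2)[OF R]
    by (intro CollectI exI[of _ 1]) simp
  fix u v assume "u \<in> adjoin R x" "v \<in> adjoin R x"
  then obtain p q where p: "u = poly p x" "\<And>i. coeff p i \<in> R" and q: "v = poly q x" "\<And>i. coeff q i \<in> R"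
    unfolding adjoin_def by blast
  show "u - v \<in> adjoin R x"
    unfolding adjoin_def using p q R by (intro CollectI exI[of _ "p - q"]) (auto intro: subring_closed)
  show "u * v \<in> adjoin R x"
    unfolding adjoin_def using p q R
    by (intro CollectI exI[of _ "p * q"]) (auto simp: coeff_mult intro!: subring_closed subring_sum)
qed

lemma subset_adjoin: "subring R \<Longrightarrow> R \<subseteq> adjoin R x"
proof
  fix c assume "subring R" "c \<in> R"
  then show "c \<in> adjoin R x"
    unfolding adjoin_def
    by (intro CollectI exI[of _ "[:c:]"]) (auto simp: coeff_pCons subring_closed split: nat.split)
qed

lemma adjoin_self: "subring R \<Longrightarrow> x \<in> adjoin R x"
  unfolding adjoin_def
  by (intro CollectI exI[of _ "[:0, 1:]"]) (auto simp: coeff_pCons subring_closed split: nat.split)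

text \<open>The units of the form \<open>1 + a c\<close> are closed under powers; this keeps the powers of such a unit under
  control when its inverse is adjoined.\<close>

lemma one_plus_multiple_power:
  assumes R: "subring R" "a \<in> R" "c \<in> R"
  shows "\<exists>d\<in>R. (1 + a * c) ^ k = 1 + a * d"
proof (induction k)
  case 0
  show ?case using subring_closed(2)[OF R(1)] by (intro bexI[of _ 0]) auto
next
  case (Suc k)
  then obtain d where "d \<in> R" "(1 + a * c) ^ k = 1 + a * d" by blast
  then show ?case using R
    by (intro bexI[of _ "c + d + a * c * d"]) (auto intro!: subring_closed simp: algebra_simps)
qed

text \<open>Elimination step of Chevalley's argument.  The expression of \<open>y\<close> in terms of \<open>inverse x\<close>, multiplied by
  \<open>a\<close>, turns into an expression of a power \<open>x ^ n\<close> by lower powers of \<open>x\<close>, once the constant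
  coefficient is moved to the other side and the resulting unit \<open>1 - a e\<close> divided out.  Substituting it
  for the top term of the other expression of \<open>y\<close> lowers the degree.\<close>

lemma lower_degree:
  fixes x :: "'a::field"
  assumes R: "subring R" and x: "x \<noteq> 0"
    and p: "\<And>i. coeff p i \<in> R" "degree p \<le> n" "poly p x = y"
    and q: "\<And>i. coeff q i \<in> R" "degree q \<le> m" "poly q (inverse x) = y"
    and mn: "0 < m" "m \<le> n"
    and a: "a \<in> R" "a * y = 1"
    and unit: "\<And>c. c \<in> R \<Longrightarrow> 1 + a * c \<noteq> 0 \<and> inverse (1 + a * c) \<in> R"
  shows "\<exists>p'. (\<forall>i. coeff p' i \<in> R) \<and> degree p' \<le> n - 1 \<and> poly p' x = y"
proof -
  obtain e q' where qe: "q = pCons e q'" by (cases q)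
  have e: "e \<in> R" and q': "coeff q' i \<in> R" for i
    using q(1)[of 0] q(1)[of "Suc i"] by (simp_all add: qe)
  have dq': "degree q' \<le> n - 1" using q(2) mn by (cases "q' = 0") (auto simp: qe)
  define v where "v = inverse (1 + a * (- e))"
  have v: "v \<in> R" "v * (1 - a * e) = 1"
    using unit[of "- e"] e R by (auto simp: v_def subring_closed)
  have ve: "1 - a * e = a * (inverse x * poly q' (inverse x))"
    using q(3) a(2) by (auto simp: qe algebra_simps)
  have one: "1 = a * v * (inverse x * poly q' (inverse x))"
    using v(2) unfolding ve by (simp add: ac_simps)
  define r where "r = smult (a * v) (monom 1 (n - 1 - degree q') * reflect_poly q')"
  have r_coeff: "coeff r i \<in> R" for i
    using R a v q'
    by (auto simp: r_def coeff_monom_mult coeff_reflect_poly intro!: subring_closed)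
  have r_deg: "degree r \<le> n - 1"
  proof -
    have "degree r \<le> degree (monom (1::'a) (n - 1 - degree q') * reflect_poly q')"
      unfolding r_def by (rule degree_smult_le)
    also have "\<dots> \<le> (n - 1 - degree q') + degree q'"
      by (intro order.trans[OF degree_mult_le] add_mono degree_monom_le degree_reflect_poly_le)
    also have "\<dots> = n - 1" using dq' by simp
    finally show ?thesis .
  qed
  have "poly r x = a * v * (x ^ (n - 1 - degree q') * x ^ degree q' * poly q' (inverse x))"
    using x by (simp add: r_def poly_monom poly_reflect_poly_nz)
  also have "x ^ (n - 1 - degree q') * x ^ degree q' = x ^ (n - 1)"
    using dq' by (metis le_add_diff_inverse2 power_add)
  also have "a * v * (x ^ (n - 1) * poly q' (inverse x)) = x ^ n * (a * v * (inverse x * poly q' (inverse x)))"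
    using x mn by (cases n) auto
  also have "\<dots> = x ^ n" unfolding one[symmetric] by simp
  finally have r_val: "poly r x = x ^ n" .
  define p' where "p' = p - monom (coeff p n) n + smult (coeff p n) r"
  have "coeff p' i \<in> R" for i
    using p r_coeff R by (auto simp: p'_def intro!: subring_closed)
  moreover have "degree p' \<le> n - 1"
  proof -
    have "degree (p - monom (coeff p n) n) \<le> n - 1"
      using p(2) mn by (intro degree_le) (auto intro: coeff_eq_0)
    moreover have "degree (smult (coeff p n) r) \<le> n - 1"
      using r_deg degree_smult_le order.trans by blast
    ultimately show ?thesis unfolding p'_def by (rule degree_add_le)
  qed
  moreover have "poly p' x = y"
    by (simp add: p'_def poly_monom r_val p(3))
  ultimately show ?thesis by blast
qed

text \<open>If neither \<open>x\<close> nor \<open>inverse x\<close> were in \<open>R\<close>, then by maximality \<open>y\<close> would be a polynomial in either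
  of them, and the polynomial of larger degree could be shortened for ever.\<close>

lemma maximal_subring_valuation:
  fixes y :: "'a::field"
  assumes R: "subring R" and y: "inverse y \<in> R" "y \<notin> R"
    and max: "\<And>R'. subring R' \<Longrightarrow> R \<subseteq> R' \<Longrightarrow> y \<notin> R' \<Longrightarrow> R' = R"
  shows "valuation_ring R"
proof -
  have y0: "y \<noteq> 0" using y subring_closed(2)[OF R] by auto
  define a where "a = inverse y"
  have a: "a \<in> R" "a * y = 1" using y y0 by (auto simp: a_def)
  have adj: "y \<in> adjoin R x" if "x \<notin> R" for x
    using max[OF subring_adjoin[OF R] subset_adjoin[OF R], of x] adjoin_self[OF R, of x] that
    by auto
  \<comment> \<open>Adjoining the inverse would yield \<open>y\<close>; clearing denominators then puts \<open>y\<close> plus an element of \<open>R\<close> into \<open>R\<close>.\<close>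
  have unit: "1 + a * c \<noteq> 0 \<and> inverse (1 + a * c) \<in> R" if c: "c \<in> R" for c
  proof
    let ?u = "1 + a * c"
    show u0: "?u \<noteq> 0"
    proof
      assume "?u = 0"
      then have "y + (a * y) * c = 0" by (metis distrib_left mult.assoc mult.commute mult.right_neutral mult_zero_right)
      then have "y = - c" unfolding a(2) by (simp add: eq_neg_iff_add_eq_0)
      then show False using c y R by (auto intro: subring_closed)
    qed
    show "inverse ?u \<in> R"
    proof (rule ccontr)
      assume "inverse ?u \<notin> R"
      then obtain p where p: "y = poly p (inverse ?u)" "\<And>i. coeff p i \<in> R"
        using adj unfolding adjoin_def by blast
      obtain d where d: "d \<in> R" "?u ^ degree p = 1 + a * d"
        using one_plus_multiple_power[OF R a(1) c] by blast
      have u: "?u \<in> R" using R a c by (auto intro!: subring_closed)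
      have "poly (reflect_poly p) ?u \<in> R"
        using R p(2) u by (intro poly_in_subring) (auto simp: coeff_reflect_poly subring_closed)
      also have "poly (reflect_poly p) ?u = ?u ^ degree p * y"
        using u0 by (simp add: poly_reflect_poly_nz p(1))
      also have "\<dots> = y + d" using a(2) by (simp add: d(2) algebra_simps)
      finally have "y + d - d \<in> R" using d(1) by (rule subring_closed(4)[OF R])
      then show False using y by simp
    qed
  qed
  define rep where "rep x n \<longleftrightarrow> (\<exists>p. (\<forall>i. coeff p i \<in> R) \<and> degree p \<le> n \<and> poly p x = y)" for x n
  have rep_pos: "0 < n" if rep: "rep x n" for x n
  proof (rule ccontr)
    assume "\<not> 0 < n"
    then obtain p where "\<forall>i. coeff p i \<in> R" "degree p = 0" "poly p x = y"
      using rep by (auto simp: rep_def)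
    then show False using y by (auto elim!: degree_eq_zeroE simp: coeff_pCons split: nat.splits)
  qed
  have rep_lower: "rep x (n - 1)" if "x \<noteq> 0" "rep x n" "rep (inverse x) m" "m \<le> n" for x n m
    using that rep_pos[OF that(3)] lower_degree[OF R that(1) _ _ _ _ _ _ _ that(4) a unit]
    unfolding rep_def by blast
  have "x \<in> R \<or> inverse x \<in> R" for x
  proof (rule ccontr)
    assume no: "\<not> (x \<in> R \<or> inverse x \<in> R)"
    then have x0: "x \<noteq> 0" using subring_closed(2)[OF R] by auto
    have ex: "\<exists>n. rep z n" if "z \<notin> R" for z
      using adj[OF that] unfolding adjoin_def rep_def by force
    define n where "n = (LEAST n. rep x n)"
    define m where "m = (LEAST n. rep (inverse x) n)"
    have n: "rep x n" and m: "rep (inverse x) m"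
      using ex[of x] ex[of "inverse x"] no LeastI_ex unfolding n_def m_def by blast+
    have "m \<le> n \<or> n \<le> m" by linarith
    then show False
    proof
      assume "m \<le> n"
      then have "rep x (n - 1)" using x0 n m by (intro rep_lower)
      then have "n \<le> n - 1" unfolding n_def by (rule Least_le)
      then show False using rep_pos[OF n] by simp
    next
      assume "n \<le> m"
      then have "rep (inverse x) (m - 1)" using x0 n m by (intro rep_lower[of _ _ n]) auto
      then have "m \<le> m - 1" unfolding m_def by (rule Least_le)
      then show False using rep_pos[OF m] by simp
    qed
  qed
  then show ?thesis using R by (simp add: valuation_ring_def)
qed

theorem valuation_ring_avoiding:
  fixes y :: "'a::field"
  assumes "subring R" "inverse y \<in> R" "y \<notin> R"
  shows "\<exists>S. R \<subseteq> S \<and> y \<notin> S \<and> valuation_ring S"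
proof -
  let ?A = "{S. subring S \<and> R \<subseteq> S \<and> y \<notin> S}"
  have "\<exists>M\<in>?A. \<forall>X\<in>?A. M \<subseteq> X \<longrightarrow> X = M"
  proof (rule subset_Zorn_nonempty)
    show "?A \<noteq> {}" using assms by blast
    fix C assume C: "C \<noteq> {}" "subset.chain ?A C"
    then have sub: "subring S" "R \<subseteq> S" "y \<notin> S" if "S \<in> C" for S
      using that by (auto simp: subset_chain_def)
    have "subring (\<Union>C)"
      unfolding subring_def
    proof (intro conjI ballI)
      show "1 \<in> \<Union>C" using C(1) sub(1) subring_closed(1) by blast
      fix u v assume "u \<in> \<Union>C" "v \<in> \<Union>C"
      then obtain S T where "S \<in> C" "u \<in> S" "T \<in> C" "v \<in> T" by blast
      moreover from this have "S \<subseteq> T \<or> T \<subseteq> S" using C(2) by (auto simp: subset_chain_def)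
      ultimately obtain S where S: "S \<in> C" "u \<in> S" "v \<in> S" by blast
      then show "u - v \<in> \<Union>C" "u * v \<in> \<Union>C"
        using subring_closed(4,6)[OF sub(1)[OF S(1)] S(2,3)] by blast+
    qed
    then show "\<Union>C \<in> ?A" using C(1) sub by blast
  qed
  then obtain M where "M \<in> ?A" and max: "\<forall>X\<in>?A. M \<subseteq> X \<longrightarrow> X = M" by (rule bexE)
  then have M: "subring M" "R \<subseteq> M" "y \<notin> M" by auto
  have "valuation_ring M"
  proof (rule maximal_subring_valuation[OF M(1) _ M(3)])
    show "inverse y \<in> M" using assms(2) M(2) by auto
    show "X = M" if "subring X" "M \<subseteq> X" "y \<notin> X" for X
      using max that M(2) by simp
  qed
  then show ?thesis using M by blast
qed

section \<open>Realizations over a valued field\<close>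

text \<open>A valuation ring containing the reals is a place with values in an extension of the real
  numbers: reduction modulo the infinitesimals plays the role of passing to the limit.\<close>

locale real_place =
  fixes R :: "'a::real_field set"
  assumes valuation: "valuation_ring R"
    and of_real_in: "of_real r \<in> R"
begin

definition infinitesimals :: "'a set" where
  "infinitesimals = {x \<in> R. x = 0 \<or> inverse x \<notin> R}"

lemma R_subring: "subring R"
  using valuation by (simp add: valuation_ring_def)

lemmas R_closed = subring_closed[OF R_subring]

lemma R_power: "x \<in> R \<Longrightarrow> x ^ k \<in> R"
  using R_subring by (rule subring_power)

lemma R_total: "x \<in> R \<or> inverse x \<in> R"
  using valuation by (simp add: valuation_ring_def)

lemma R_half: "x + x \<in> R \<Longrightarrow> x \<in> R"
proof -
  assume "x + x \<in> R"
  then have "of_real (1 / 2) * (x + x) \<in> R" by (rule R_closed(6)[OF of_real_in])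
  moreover have "of_real (1 / 2) * (x + x) = x" by (simp add: field_simps)
  ultimately show ?thesis by simp
qed

lemma m_in_R: "x \<in> infinitesimals \<Longrightarrow> x \<in> R"
  by (simp add: infinitesimals_def)

lemma m_zero: "0 \<in> infinitesimals"
  by (simp add: infinitesimals_def R_closed)

lemma m_mult: "r * x \<in> infinitesimals" "x * r \<in> infinitesimals"
  if r: "r \<in> R" and x: "x \<in> infinitesimals"
proof -
  have "inverse (r * x) \<notin> R" if "r * x \<noteq> 0"
  proof
    assume "inverse (r * x) \<in> R"
    then have "r * inverse (r * x) \<in> R" using r by (intro R_closed(6))
    also have "r * inverse (r * x) = inverse x" using that by (simp add: field_simps)
    finally show False using x that by (auto simp: infinitesimals_def)
  qed
  then show "r * x \<in> infinitesimals"
    using r x by (auto simp: infinitesimals_def R_closed)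
  then show "x * r \<in> infinitesimals" by (simp add: mult.commute)
qed

lemma m_uminus: "x \<in> infinitesimals \<Longrightarrow> - x \<in> infinitesimals"
  using m_mult(1)[of "- 1" x] by (simp add: R_closed)

lemma m_add:
  assumes x: "x \<in> infinitesimals" and y: "y \<in> infinitesimals"
  shows "x + y \<in> infinitesimals"
proof -
  have *: "u + v \<in> infinitesimals"
    if "u \<in> infinitesimals" "v \<in> infinitesimals" "v \<noteq> 0" "u * inverse v \<in> R" for u v
  proof -
    have "u + v = (u * inverse v + 1) * v" using that(3) by (simp add: field_simps)
    then show ?thesis using that m_mult(1)[of "u * inverse v + 1" v] by (simp add: R_closed)
  qed
  show ?thesis
  proof (cases "x = 0 \<or> y = 0")
    case True
    then show ?thesis using x y by auto
  next
    case False
    have "x * inverse y \<in> R \<or> y * inverse x \<in> R"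
      using R_total[of "x * inverse y"] by (simp add: mult.commute)
    then show ?thesis using False *[OF x y] *[OF y x] by (auto simp: add.commute)
  qed
qed

lemma m_diff: "x \<in> infinitesimals \<Longrightarrow> y \<in> infinitesimals \<Longrightarrow> x - y \<in> infinitesimals"
  using m_add[of x "- y"] m_uminus[of y] by simp

lemma m_sum: "(\<And>i. i \<in> I \<Longrightarrow> h i \<in> infinitesimals) \<Longrightarrow> sum h I \<in> infinitesimals"
  by (induction I rule: infinite_finite_induct) (auto intro: m_zero m_add)

lemma inverse_unit: "x \<in> R \<Longrightarrow> x \<notin> infinitesimals \<Longrightarrow> x \<noteq> 0 \<and> inverse x \<in> R"
  by (auto simp: infinitesimals_def)

lemma inverse_infinite: "x \<notin> R \<Longrightarrow> x \<noteq> 0 \<and> inverse x \<in> infinitesimals"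
  using R_total[of x] R_closed(2) by (auto simp: infinitesimals_def)

lemma m_prime:
  assumes "x \<in> R" "x * y \<in> infinitesimals"
  shows "x \<in> infinitesimals \<or> y \<in> infinitesimals"
proof (rule disjCI)
  assume "y \<notin> infinitesimals"
  show "x \<in> infinitesimals"
  proof (rule ccontr)
    assume "x \<notin> infinitesimals"
    then have x: "x \<noteq> 0" "inverse x \<in> R" using inverse_unit assms(1) by auto
    have "inverse x * (x * y) \<in> infinitesimals" by (rule m_mult(1)[OF x(2) assms(2)])
    moreover have "inverse x * (x * y) = y" using x(1) by simp
    ultimately show False using \<open>y \<notin> infinitesimals\<close> by simp
  qed
qed

lemma m_square: "x \<in> R \<Longrightarrow> x\<^sup>2 \<in> infinitesimals \<Longrightarrow> x \<in> infinitesimals"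
  using m_prime[of x x] by (auto simp: power2_eq_square)

lemma of_real_infinitesimal_iff: "of_real r \<in> infinitesimals \<longleftrightarrow> r = 0"
  using of_real_in[of r] of_real_in[of "inverse r"] by (auto simp: infinitesimals_def)

lemma square_in_R: "x\<^sup>2 \<in> R \<Longrightarrow> x \<in> R"
proof (rule ccontr)
  assume x2: "x\<^sup>2 \<in> R" and x: "x \<notin> R"
  have "inverse x * x\<^sup>2 \<in> R"
    using inverse_infinite[OF x] x2 by (intro R_closed(6)) (auto intro: m_in_R)
  moreover have "inverse x * x\<^sup>2 = x" using inverse_infinite[OF x] by (simp add: power2_eq_square)
  ultimately show False using x by simp
qed

text \<open>Valuation rings order elements by divisibility, so the largest of three numbers divides the others.  For
  a point at infinity this extracts its direction.\<close>

lemma common_scale: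
  obtains M a b c where "x = a * M" "y = b * M" "z = c * M"
    "a \<in> R" "b \<in> R" "c \<in> R" "a = 1 \<or> b = 1 \<or> c = 1"
proof -
  define dom where "dom v u \<longleftrightarrow> (\<exists>c\<in>R. u = c * v)" for u v
  have total: "dom v u \<or> dom u v" for u v
  proof (cases "u = 0 \<or> v = 0")
    case True
    then show ?thesis using R_closed(2) by (force simp: dom_def)
  next
    case False
    then have "u = (u * inverse v) * v" "v = inverse (u * inverse v) * u" by auto
    then show ?thesis using R_total[of "u * inverse v"] unfolding dom_def by blast
  qed
  have trans: "dom w u" if "dom v u" "dom w v" for u v w
    using that unfolding dom_def by (metis R_closed(6) mult.assoc)
  have refl: "dom u u" for u using R_closed(1) by (force simp: dom_def)
  have "\<exists>M\<in>{x, y, z}. dom M x \<and> dom M y \<and> dom M z"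
    using total[of x y] total[of y z] total[of x z] trans refl by blast
  then obtain M a b c where *: "M \<in> {x, y, z}" "a \<in> R" "b \<in> R" "c \<in> R" "x = a * M" "y = b * M" "z = c * M"
    unfolding dom_def by blast
  show thesis
  proof (cases "M = 0")
    case True
    then show thesis using that[of 1 0 1 1] * R_closed(1) by auto
  next
    case False
    then show thesis using that * by auto
  qed
qed

end

text \<open>The number \<open>j\<close> is a square root of \<open>-1\<close> up to an infinitesimal, and \<open>(0, 1, j)\<close> is an isotropic
  direction, orthogonal to the plane \<open>Y + j Z = 0\<close> which contains it.\<close>

locale place_of_realization = real_place R for R :: "'a::real_field set" +
  fixes X Y Z :: "'v \<Rightarrow> 'a" and E :: "'v set set" and j :: 'a
  assumes edge: "{u, v} \<in> E \<Longrightarrow> (X u - X v)\<^sup>2 + (Y u - Y v)\<^sup>2 + (Z u - Z v)\<^sup>2 \<in> R"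
    and j: "j \<in> R" "1 + j\<^sup>2 \<in> infinitesimals"
begin

definition finite_at :: "'v \<Rightarrow> bool" where
  "finite_at v \<longleftrightarrow> X v \<in> R \<and> Y v \<in> R \<and> Z v \<in> R"

definition on_plane :: "'v \<Rightarrow> bool" where
  "on_plane v \<longleftrightarrow> finite_at v \<and> Y v + j * Z v \<in> infinitesimals"

definition towards :: "'v \<Rightarrow> bool" where
  "towards v \<longleftrightarrow> Y v \<notin> R \<and> X v / Y v \<in> infinitesimals \<and> Z v / Y v - j \<in> infinitesimals"

text \<open>Up to infinitesimals, \<open>y\<^sup>2 + z\<^sup>2\<close> factors as \<open>(y + j z) (y - j z)\<close>.\<close>

lemma isotropic:
  assumes "y \<in> R" "z \<in> R" "y + j * z \<in> infinitesimals"
  shows "y\<^sup>2 + z\<^sup>2 \<in> infinitesimals"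
proof -
  have "y\<^sup>2 + z\<^sup>2 = (y - j * z) * (y + j * z) + (1 + j\<^sup>2) * z\<^sup>2"
    by (simp add: algebra_simps power2_eq_square)
  then show ?thesis
    using assms j by (auto intro!: m_add m_mult(1)[of _ "y + j * z"] m_mult(2)[of _ "1 + j\<^sup>2"] R_closed R_power)
qed

text \<open>Both \<open>w\<close> and \<open>w'\<close> have finite distance to \<open>v\<close>.  The difference of the squared distances shows that
  the inner product of \<open>v\<close> with \<open>w' - w\<close> is finite.  Dividing by the infinite number \<open>Y v\<close> leaves an
  infinitesimal inner product of \<open>w' - w\<close> with \<open>(0, 1, j)\<close>.\<close>

lemma finite_neighbour_on_plane:
  assumes "{w, v} \<in> E" "{w', v} \<in> E" "on_plane w" "towards v" "finite_at w'"
  shows "on_plane w'"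
proof -
  have fin: "X w \<in> R" "Y w \<in> R" "Z w \<in> R" "X w' \<in> R" "Y w' \<in> R" "Z w' \<in> R"
    and w: "Y w + j * Z w \<in> infinitesimals"
    using assms(3,5) by (auto simp: on_plane_def finite_at_def)
  let ?a = "X w' - X w" and ?b = "Y w' - Y w" and ?c = "Z w' - Z w"
  have abc: "?a \<in> R" "?b \<in> R" "?c \<in> R" using fin by (auto intro: R_closed)
  have v: "Y v \<noteq> 0" "inverse (Y v) \<in> infinitesimals"
    "X v / Y v \<in> infinitesimals" "Z v / Y v - j \<in> infinitesimals"
    using assms(4) inverse_infinite by (auto simp: towards_def)
  define T where "T = X v * ?a + Y v * ?b + Z v * ?c"
  define D where "D u = (X u - X v)\<^sup>2 + (Y u - Y v)\<^sup>2 + (Z u - Z v)\<^sup>2" for u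
  define N where "N u = (X u)\<^sup>2 + (Y u)\<^sup>2 + (Z u)\<^sup>2" for u
  have "T + T = D w - D w' - N w + N w'"
    by (simp add: T_def D_def N_def algebra_simps power2_eq_square)
  moreover have "D w \<in> R" "D w' \<in> R" using edge assms(1,2) by (auto simp: D_def)
  moreover have "N w \<in> R" "N w' \<in> R" using fin by (auto simp: N_def intro!: R_closed R_power)
  ultimately have "T + T \<in> R" by (auto intro!: R_closed)
  then have "T \<in> R" by (rule R_half)
  have "?b + j * ?c = inverse (Y v) * T - (X v / Y v) * ?a - (Z v / Y v - j) * ?c"
    using v(1) by (simp add: T_def field_simps)
  also have "\<dots> \<in> infinitesimals"
    by (rule m_diff[OF m_diff[OF m_mult(2)[OF _ v(2)] m_mult(2)[OF _ v(3)]] m_mult(2)[OF _ v(4)]])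
      (use \<open>T \<in> R\<close> abc in auto)
  finally have "(?b + j * ?c) + (Y w + j * Z w) \<in> infinitesimals" using w by (rule m_add)
  then show ?thesis using assms(5) by (simp add: on_plane_def algebra_simps)
qed

text \<open>Let \<open>(a, b, c)\<close> be the direction of \<open>v'\<close>.  All sides of the triangle are finite, hence so is the inner product
  of \<open>v - w\<close> and \<open>v' - w\<close>, and \<open>v' - w\<close> has finite square.  In the limit, \<open>(a, b, c)\<close> is
  therefore isotropic and orthogonal to \<open>(0, 1, j)\<close>, which forces it to be a multiple of \<open>(0, 1, j)\<close>.\<close>

lemma infinite_neighbour_towards:
  assumes "{w, v} \<in> E" "{w, v'} \<in> E" "{v, v'} \<in> E"
    and "finite_at w" "towards v" "\<not> finite_at v'"
  shows "towards v'"
proof -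
  have w: "X w \<in> R" "Y w \<in> R" "Z w \<in> R" using assms(4) by (auto simp: finite_at_def)
  obtain M a b c where abc: "a \<in> R" "b \<in> R" "c \<in> R" "a = 1 \<or> b = 1 \<or> c = 1"
    and v': "X v' = a * M" "Y v' = b * M" "Z v' = c * M"
    using common_scale[of "X v'" "Y v'" "Z v'"] by metis
  have M: "M \<notin> R" using assms(6) abc v' by (auto simp: finite_at_def R_closed)
  define h where "h = inverse M"
  define k where "k = inverse (Y v)"
  define e1 where "e1 = X v / Y v"
  define e3 where "e3 = Z v / Y v - j"
  have h: "h \<in> infinitesimals" "h \<in> R" "h * M = 1"
    using inverse_infinite[OF M] m_in_R by (auto simp: h_def)
  have v: "k \<in> infinitesimals" "k \<in> R" "k * Y v = 1" "e1 \<in> infinitesimals" "e3 \<in> infinitesimals"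
    using assms(5) inverse_infinite m_in_R by (auto simp: towards_def k_def e1_def e3_def)
  have kX: "k * X v = e1" and kZ: "k * Z v = j + e3"
    by (simp_all add: k_def e1_def e3_def field_simps)
  define T where "T = (X v - X w) * (X v' - X w) + (Y v - Y w) * (Y v' - Y w) + (Z v - Z w) * (Z v' - Z w)"
  define D where "D u u' = (X u - X u')\<^sup>2 + (Y u - Y u')\<^sup>2 + (Z u - Z u')\<^sup>2" for u u'
  have D: "D w v \<in> R" "D w v' \<in> R" "D v v' \<in> R" using edge assms(1-3) by (auto simp: D_def)
  have "T + T = D w v + D w v' - D v v'"
    by (simp add: T_def D_def algebra_simps power2_eq_square)
  then have "T + T \<in> R" using D by (auto intro!: R_closed)
  then have T: "T \<in> R" by (rule R_half)
  have hv': "h * X v' = a" "h * Y v' = b" "h * Z v' = c"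
    using h(3) by (simp_all add: v' algebra_simps)
  have hD: "h\<^sup>2 * D w v' = (h * X v' - h * X w)\<^sup>2 + (h * Y v' - h * Y w)\<^sup>2 + (h * Z v' - h * Z w)\<^sup>2"
    by (simp add: D_def algebra_simps power2_eq_square)
  have khT: "k * h * T = (k * X v - k * X w) * (h * X v' - h * X w)
      + (k * Y v - k * Y w) * (h * Y v' - h * Y w) + (k * Z v - k * Z w) * (h * Z v' - h * Z w)"
    by (simp add: T_def algebra_simps)
  \<comment> \<open>Orthogonality to \<open>(0, 1, j)\<close>: the inner product \<open>T\<close>, rescaled by the infinitesimals \<open>h\<close> and \<open>k\<close>.\<close>
  have "b + j * c = k * (h * T) + h * (Y w + j * Z w) - (e1 * (a - h * X w)
      + k * (- X w * (a - h * X w) - Y w * (b - h * Y w) - Z w * (c - h * Z w)) + e3 * (c - h * Z w))"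
    using khT unfolding hv' kX kZ v(3) by (simp add: algebra_simps)
  also have "\<dots> \<in> infinitesimals"
    using w abc j(1) T h v by (intro m_diff m_add m_mult(2)) (auto intro!: R_closed)
  finally have bc: "b + j * c \<in> infinitesimals" .
  define q where "q = a * X w + b * Y w + c * Z w"
  define N where "N = (X w)\<^sup>2 + (Y w)\<^sup>2 + (Z w)\<^sup>2"
  have qN: "q \<in> R" "N \<in> R" using w abc(1-3) by (auto simp: q_def N_def intro!: R_closed R_power)
  \<comment> \<open>Isotropy of \<open>(a, b, c)\<close>, in which \<open>b\<^sup>2 + c\<^sup>2\<close> is already known to be infinitesimal.\<close>
  have "a\<^sup>2 = h * (h * D w v' + (q + q) - h * N) - (b\<^sup>2 + c\<^sup>2)"
    using hD unfolding hv' by (simp add: q_def N_def algebra_simps power2_eq_square)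
  also have "\<dots> \<in> infinitesimals"
    by (rule m_diff[OF m_mult(2)[OF _ h(1)] isotropic[OF abc(2,3) bc]])
      (intro R_closed(4-6) qN D h)
  finally have a: "a \<in> infinitesimals" by (rule m_square[OF abc(1)])
  have "c - j * b = (1 + j\<^sup>2) * c - j * (b + j * c)"
    by (simp add: algebra_simps power2_eq_square)
  also have "\<dots> \<in> infinitesimals" using j abc bc by (intro m_diff m_mult)
  finally have cb: "c - j * b \<in> infinitesimals" .
  have "b \<notin> infinitesimals"
  proof
    assume b: "b \<in> infinitesimals"
    have "(c - j * b) + j * b \<in> infinitesimals" using cb b j by (intro m_add m_mult(1))
    then have "c \<in> infinitesimals" by simp
    then have "1 \<in> infinitesimals" using a b abc(4) by auto
    then show False using of_real_infinitesimal_iff[of 1] by simp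
  qed
  then have b: "b \<noteq> 0" "inverse b \<in> R" using abc(2) inverse_unit by auto
  have M0: "M \<noteq> 0" using M R_closed(2) by auto
  have "Y v' \<notin> R"
  proof
    assume "Y v' \<in> R"
    then have "inverse b * Y v' \<in> R" using b by (intro R_closed)
    also have "inverse b * Y v' = M" using b(1) by (simp add: v' flip: mult.assoc)
    finally show False using M by simp
  qed
  moreover have "X v' / Y v' = a * inverse b" "Z v' / Y v' - j = (c - j * b) * inverse b"
    using M0 b(1) by (simp_all add: v' field_simps)
  ultimately show ?thesis
    using m_mult(2)[OF b(2) a] m_mult(2)[OF b(2) cb] by (simp add: towards_def)
qed

text \<open>On the isotropic plane only the first coordinate contributes to the length, so in the limit its
  difference is a square root of \<open>l\<^sup>2\<close>.\<close>

lemma edge_on_plane_signed_length: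
  assumes "on_plane u" "on_plane v"
    and "(X u - X v)\<^sup>2 + (Y u - Y v)\<^sup>2 + (Z u - Z v)\<^sup>2 = of_real (l\<^sup>2)"
  shows "\<exists>\<sigma>\<in>{1, -1::real}. X u - X v - of_real (\<sigma> * l) \<in> infinitesimals"
proof -
  have fin: "X u - X v \<in> R" "Y u - Y v \<in> R" "Z u - Z v \<in> R"
    using assms(1,2) by (auto simp: on_plane_def finite_at_def intro: R_closed)
  have "(Y u - Y v) + j * (Z u - Z v) = (Y u + j * Z u) - (Y v + j * Z v)"
    by (simp add: algebra_simps)
  also have "\<dots> \<in> infinitesimals" using assms(1,2) by (auto simp: on_plane_def intro: m_diff)
  finally have "- ((Y u - Y v)\<^sup>2 + (Z u - Z v)\<^sup>2) \<in> infinitesimals"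
    using fin by (intro m_uminus isotropic)
  moreover have "- ((Y u - Y v)\<^sup>2 + (Z u - Z v)\<^sup>2) =
      (X u - X v - of_real l) * (X u - X v + of_real l)"
    using assms(3) by (simp add: algebra_simps power2_eq_square)
  ultimately have "X u - X v - of_real l \<in> infinitesimals \<or> X u - X v + of_real l \<in> infinitesimals"
    using fin by (intro m_prime) (auto intro!: R_closed of_real_in)
  then show ?thesis by auto
qed

end

section \<open>Cycles from strips of triangles\<close>

lemma face_of_triple:
  assumes "triangular_polyhedron K" "{a, b, c} \<in> faces K"
  shows "a \<noteq> b" "a \<noteq> c" "b \<noteq> c" "{a, b} \<in> edges K" "{a, c} \<in> edges K" "{b, c} \<in> edges K"
    and "a \<in> vertices K" "b \<in> vertices K" "c \<in> vertices K"
proof -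
  have F: "{a, b, c} \<in> K" "card {a, b, c} = 3" using assms(2) by (auto simp: faces_def)
  show ne: "a \<noteq> b" "a \<noteq> c" "b \<noteq> c"
    using F(2) by (auto simp: card_insert_if split: if_splits)
  have K: "T \<in> K" if "T \<subseteq> {a, b, c}" "T \<noteq> {}" for T
    using assms(1) F(1) that unfolding triangular_polyhedron_def abstract_simplicial_complex_def by blast
  show "{a, b} \<in> edges K" "{a, c} \<in> edges K" "{b, c} \<in> edges K"
    using ne by (auto simp: edges_def intro!: K)
  show "a \<in> vertices K" "b \<in> vertices K" "c \<in> vertices K"
    by (auto simp: vertices_def intro!: K)
qed

lemma face_cases:
  assumes "F \<in> faces K" "a \<in> F" "b \<in> F" "a \<noteq> b"
  obtains c where "F = {a, b, c}" "c \<noteq> a" "c \<noteq> b"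
proof -
  have "card F = 3" using assms(1) by (simp add: faces_def)
  then have "finite F" by (metis card.infinite zero_neq_numeral)
  have "card (F - {a, b}) = card F - card {a, b}"
    using assms by (intro card_Diff_subset) auto
  then have "card (F - {a, b}) = 1"
    using \<open>card F = 3\<close> assms(4) by simp
  then obtain c where "F - {a, b} = {c}" by (auto simp: card_1_singleton_iff)
  then show thesis using assms that by blast
qed

text \<open>Parity replaces following the strip triangle by triangle.  Let \<open>S\<close> be the set of vertices reachable from \<open>w\<close>.
  Count the pairs of an edge joining \<open>S\<close> to \<open>B\<close> and a face containing it.  Every edge lies in
  two faces, so the number is even.  On the other hand, a face contains zero or two such edges: if
  its third vertex is in \<open>A\<close>, it is reachable as well.  The one exception is the face \<open>{w, w', n}\<close>,
  whose edge \<open>{w, w'}\<close> must not be used; it would contribute a single edge if \<open>w'\<close> were not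
  reachable.\<close>

lemma path_along_mixed_strip:
  assumes K: "triangular_polyhedron K"
    and disj: "A \<inter> B = {}"
    and closed: "\<And>a b c. a \<in> A \<Longrightarrow> b \<in> B \<Longrightarrow> {a, b, c} \<in> faces K \<Longrightarrow> c \<in> A \<or> c \<in> B"
    and n: "{w, w', n} \<in> faces K" "n \<in> B"
    and s: "{w, w', s} \<in> faces K" "s \<notin> B" "s \<noteq> n"
    and w: "w \<in> A" "w' \<in> A"
  shows "(w, w') \<in> {(u, v). u \<in> A \<and> v \<in> A \<and> {u, v} \<in> edges K \<and> {u, v} \<noteq> {w, w'}}\<^sup>*"
    (is "_ \<in> ?r\<^sup>*")
proof (rule ccontr)
  assume "(w, w') \<notin> ?r\<^sup>*"
  define S where "S = {v. (w, v) \<in> ?r\<^sup>*}"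
  have wS: "w \<in> S" and w'S: "w' \<notin> S" using \<open>(w, w') \<notin> ?r\<^sup>*\<close> by (auto simp: S_def)
  have S_step: "v \<in> S" if "u \<in> S" "(u, v) \<in> ?r" for u v
    using that unfolding S_def by (auto intro: rtrancl_into_rtrancl)
  have SA: "S \<subseteq> A"
  proof
    fix v assume "v \<in> S"
    then have "(w, v) \<in> ?r\<^sup>*" by (simp add: S_def)
    then show "v \<in> A" using w(1) by (cases rule: rtranclE) auto
  qed
  define M where "M = {e \<in> edges K. \<exists>a\<in>S. \<exists>b\<in>B. e = {a, b}}"
  have fin: "finite (faces K)" "finite M"
    using K by (auto simp: triangular_polyhedron_def faces_def edges_def M_def)
  have two: "{F \<in> faces K. {w, w'} \<subseteq> F} = {{w, w', n}, {w, w', s}}"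
  proof -
    have all: "card {F \<in> faces K. {w, w'} \<subseteq> F} = 2"
      using K face_of_triple(4)[OF K n(1)] unfolding triangular_polyhedron_def by blast
    have "{w, w', n} \<noteq> {w, w', s}"
      using face_of_triple(2,3)[OF K n(1)] s(3) by (metis insertCI insertE singletonD)
    then have "card {{w, w', n}, {w, w', s}} = card {F \<in> faces K. {w, w'} \<subseteq> F}"
      unfolding all by simp
    moreover have "{{w, w', n}, {w, w', s}} \<subseteq> {F \<in> faces K. {w, w'} \<subseteq> F}"
      using n(1) s(1) by auto
    moreover have "finite {F \<in> faces K. {w, w'} \<subseteq> F}" using fin(1) by simp
    ultimately show ?thesis by (intro card_subset_eq[symmetric])
  qed
  have "(\<Sum>F\<in>faces K. card {e \<in> M. e \<subseteq> F}) = (\<Sum>e\<in>M. card {F \<in> faces K. e \<subseteq> F})"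
    using fin by (intro sum_multicount_gen) auto
  also have "\<dots> = (\<Sum>e\<in>M. 2)"
    using K by (intro sum.cong) (auto simp: M_def triangular_polyhedron_def)
  finally have "even (\<Sum>F\<in>faces K. card {e \<in> M. e \<subseteq> F})" by simp
  moreover have "even (card {e \<in> M. e \<subseteq> F})" if F: "F \<in> faces K" "F \<noteq> {w, w', n}" for F
  proof (cases "{e \<in> M. e \<subseteq> F} = {}")
    case True
    show ?thesis unfolding True by simp
  next
    case False
    then obtain a b where ab: "a \<in> S" "b \<in> B" "{a, b} \<in> edges K" "a \<in> F" "b \<in> F"
      by (auto simp: M_def)
    have "a \<noteq> b" using ab SA disj by blast
    then obtain c where c: "F = {a, b, c}" "c \<noteq> a" "c \<noteq> b"
      using face_cases F(1) ab by metis
    have edges: "{a, c} \<in> edges K" "{b, c} \<in> edges K"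
      using face_of_triple[OF K] F(1) c(1) by blast+
    have "c \<in> A \<or> c \<in> B" using closed ab SA F(1) c(1) by blast
    then show ?thesis
    proof
      assume cB: "c \<in> B"
      have "{e \<in> M. e \<subseteq> F} = {{a, b}, {a, c}}"
      proof (intro equalityI subsetI)
        fix e assume "e \<in> {e \<in> M. e \<subseteq> F}"
        then obtain u v where "u \<in> S" "v \<in> B" "e = {u, v}" "u \<in> F" "v \<in> F"
          by (auto simp: M_def)
        moreover from this have "u \<noteq> b" "u \<noteq> c" "v \<noteq> a" using ab cB SA disj by auto
        ultimately show "e \<in> {{a, b}, {a, c}}" using c(1) by auto
      next
        fix e assume "e \<in> {{a, b}, {a, c}}"
        then show "e \<in> {e \<in> M. e \<subseteq> F}" using ab cB edges c(1) by (auto simp: M_def)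
      qed
      moreover have "{a, b} \<noteq> {a, c}" using c(3) \<open>a \<noteq> b\<close> by (auto simp: doubleton_eq_iff)
      ultimately show ?thesis by simp
    next
      assume cA: "c \<in> A"
      have "{a, c} \<noteq> {w, w'}"
      proof
        assume "{a, c} = {w, w'}"
        then have "F \<in> {F \<in> faces K. {w, w'} \<subseteq> F}" using F(1) c(1) by auto
        then have "F = {w, w', s}" using F(2) unfolding two by blast
        then have "b = s" using ab(2,5) w disj by auto
        then show False using ab(2) s(2) by simp
      qed
      then have cS: "c \<in> S" using ab(1) cA SA edges(1) by (intro S_step[OF ab(1)]) auto
      have "{e \<in> M. e \<subseteq> F} = {{a, b}, {c, b}}"
      proof (intro equalityI subsetI)
        fix e assume "e \<in> {e \<in> M. e \<subseteq> F}"
        then obtain u v where "u \<in> S" "v \<in> B" "e = {u, v}" "u \<in> F" "v \<in> F"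
          by (auto simp: M_def)
        moreover from this have "u \<noteq> b" "v \<noteq> c" "v \<noteq> a" using ab cS SA disj by auto
        ultimately show "e \<in> {{a, b}, {c, b}}" using c(1) by auto
      next
        fix e assume "e \<in> {{a, b}, {c, b}}"
        then show "e \<in> {e \<in> M. e \<subseteq> F}"
          using ab cS edges c(1) by (auto simp: M_def insert_commute)
      qed
      moreover have "{a, b} \<noteq> {c, b}" using c(2) \<open>a \<noteq> b\<close> by (auto simp: doubleton_eq_iff)
      ultimately show ?thesis by simp
    qed
  qed
  then have "even (\<Sum>F\<in>faces K - {{w, w', n}}. card {e \<in> M. e \<subseteq> F})"
    by (intro dvd_sum) auto
  moreover have "{e \<in> M. e \<subseteq> {w, w', n}} = {{w, n}}"
  proof (intro equalityI subsetI)
    fix e assume "e \<in> {e \<in> M. e \<subseteq> {w, w', n}}"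
    then obtain u v where "u \<in> S" "v \<in> B" "e = {u, v}" "u \<in> {w, w', n}" "v \<in> {w, w', n}"
      by (auto simp: M_def)
    moreover from this have "u \<noteq> n" "v \<noteq> w" "v \<noteq> w'" "u \<noteq> w'" using n(2) w w'S SA disj by auto
    ultimately show "e \<in> {{w, n}}" by auto
  next
    fix e assume "e \<in> {{w, n}}"
    then show "e \<in> {e \<in> M. e \<subseteq> {w, w', n}}"
      using wS n(2) face_of_triple(5)[OF K n(1)] by (auto simp: M_def)
  qed
  ultimately show False
    using sum.remove[OF fin(1) n(1), of "\<lambda>F. card {e \<in> M. e \<subseteq> F}"] by simp
qed

text \<open>A shortest path has no chords besides the edge \<open>{w, w'}\<close>, and it has length at least two because
  that edge is excluded.\<close>

lemma induced_cycle_of_path: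
  assumes E: "\<And>e. e \<in> E \<Longrightarrow> card e = 2"
    and w: "{w, w'} \<in> E" "w \<noteq> w'" "w \<in> A"
    and path: "(w, w') \<in> {(u, v). u \<in> A \<and> v \<in> A \<and> {u, v} \<in> E \<and> {u, v} \<noteq> {w, w'}}\<^sup>*" (is "_ \<in> ?r\<^sup>*")
  obtains vs where "distinct vs" "length vs \<ge> 3" "set vs \<subseteq> A" "w \<in> set vs" "w' \<in> set vs"
    "{e \<in> E. e \<subseteq> set vs} = {{vs ! i, vs ! (Suc i mod length vs)} | i. i < length vs}"
proof -
  define k where "k = (LEAST k. (w, w') \<in> ?r ^^ k)"
  have "(w, w') \<in> ?r ^^ k"
    unfolding k_def using rtrancl_imp_relpow[OF path] by (rule LeastI_ex)
  then obtain f where f: "f 0 = w" "f k = w'" "\<And>i. i < k \<Longrightarrow> (f i, f (Suc i)) \<in> ?r"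
    unfolding relpow_fun_conv by blast
  have min: "k \<le> l" if "(w, w') \<in> ?r ^^ l" for l
    unfolding k_def using that by (rule Least_le)
  have seg: "(f i, f l) \<in> ?r ^^ (l - i)" if "i \<le> l" "l \<le> k" for i l
    unfolding relpow_fun_conv using that f(3) by (intro exI[of _ "\<lambda>m. f (i + m)"]) auto
  have shortcut: "l \<le> i + m" if "i \<le> l" "l \<le> k" "(f i, f l) \<in> ?r ^^ m" for i l m
  proof -
    have "(w, f i) \<in> ?r ^^ i" "(f l, w') \<in> ?r ^^ (k - l)"
      using seg[of 0 i] seg[of l k] that f(1,2) by auto
    then have "(w, w') \<in> ?r ^^ (i + m + (k - l))"
      unfolding relpow_add using that(3) by blast
    then show ?thesis using min[of "i + m + (k - l)"] that by linarith
  qed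
  have ne: "f i \<noteq> f l" if "i < l" "l \<le> k" for i l
    using shortcut[of i l 0] that by auto
  have chord: "l = Suc i" if "i < l" "l \<le> k" "(f i, f l) \<in> ?r" for i l
    using shortcut[of i l 1] that by simp
  have k0: "k \<noteq> 0" using f(1,2) w(2) by (metis)
  have k1: "k \<noteq> 1" using f(1,2) f(3)[of 0] by auto
  have inA: "f i \<in> A" if "i \<le> k" for i
    using that f(1) w(3) f(3)[of "i - 1"] by (cases i) auto
  define vs where "vs = map f [0..<Suc k]"
  have len: "length vs = Suc k" by (simp add: vs_def)
  have nth: "vs ! i = f i" if "i \<le> k" for i
    using that by (simp add: vs_def nth_map_upt del: upt_Suc)
  have set: "set vs = f ` {..k}" by (auto simp: vs_def atLeast0LessThan lessThan_Suc_atMost simp del: upt_Suc)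
  have next_nth: "vs ! (Suc i mod length vs) = (if i = k then w else f (Suc i))" if "i \<le> k" for i
    using that nth[of "Suc i"] nth[of 0] f(1) by (auto simp: len)
  have "inj_on f {..k}"
    by (intro linorder_inj_onI) (auto simp: ne)
  then have "distinct vs"
    by (simp add: vs_def distinct_map atLeast0LessThan lessThan_Suc_atMost del: upt_Suc)
  moreover have "length vs \<ge> 3" using k0 k1 by (simp add: len)
  moreover have "set vs \<subseteq> A" using inA by (auto simp: set)
  moreover have "w \<in> set vs" "w' \<in> set vs" using f(1,2) by (force simp: set)+
  moreover have "{e \<in> E. e \<subseteq> set vs} = {{vs ! i, vs ! (Suc i mod length vs)} | i. i < length vs}"
  proof (intro equalityI subsetI)
    fix e assume "e \<in> {e \<in> E. e \<subseteq> set vs}"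
    then have e: "e \<in> E" "e \<subseteq> f ` {..k}" by (auto simp: set)
    obtain u v where uv: "e = {u, v}" "u \<noteq> v" using E[OF e(1)] by (auto simp: card_2_iff)
    then obtain i l where il: "u = f i" "v = f l" "i \<le> k" "l \<le> k" "i \<noteq> l" using e(2) by auto
    then obtain i l where il: "e = {f i, f l}" "i < l" "l \<le> k"
      using uv(1) by (metis insert_commute linorder_neq_iff)
    show "e \<in> {{vs ! i, vs ! (Suc i mod length vs)} | i. i < length vs}"
    proof (cases "e = {w, w'}")
      case True
      then show ?thesis
        using next_nth[of k] nth[of k] f(2) by (intro CollectI exI[of _ k]) (auto simp: len)
    next
      case False
      then have "(f i, f l) \<in> ?r" using inA[of i] inA[of l] il e(1) by simp
      then have "l = Suc i" by (rule chord[OF il(2,3)])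
      then show ?thesis
        using next_nth[of i] nth[of i] il by (intro CollectI exI[of _ i]) (auto simp: len)
    qed
  next
    fix e assume "e \<in> {{vs ! i, vs ! (Suc i mod length vs)} | i. i < length vs}"
    then obtain i where i: "i \<le> k" "e = {f i, if i = k then w else f (Suc i)}"
      using next_nth nth by (auto simp: len less_Suc_eq_le)
    then show "e \<in> {e \<in> E. e \<subseteq> set vs}"
      using f(1,2) f(3)[of i] w(1) by (auto simp: set insert_commute)
  qed
  ultimately show thesis using that by blast
qed

lemma sum_cyclic_shift:
  fixes g :: "nat \<Rightarrow> 'a::comm_monoid_add"
  shows "(\<Sum>i<N. g (Suc i mod N)) = (\<Sum>i<N. g i)"
proof (cases N)
  case (Suc m)
  have "(\<Sum>i<N. g (Suc i mod N)) = (\<Sum>i<m. g (Suc i)) + g 0"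
    by (simp add: Suc)
  also have "\<dots> = (\<Sum>i<N. g i)"
    unfolding Suc sum.lessThan_Suc_shift by (rule add.commute)
  finally show ?thesis .
qed simp

lemma cycle_edges_inj:
  assumes "distinct vs" "length vs \<ge> 3"
  shows "inj_on (\<lambda>i. {vs ! i, vs ! (Suc i mod length vs)}) {..<length vs}"
proof (rule inj_onI)
  fix i l assume il: "i \<in> {..<length vs}" "l \<in> {..<length vs}"
    and eq: "{vs ! i, vs ! (Suc i mod length vs)} = {vs ! l, vs ! (Suc l mod length vs)}"
  have lt: "Suc i mod length vs < length vs" "Suc l mod length vs < length vs"
    using assms(2) by (auto intro: mod_less_divisor)
  from eq show "i = l"
    unfolding doubleton_eq_iff
  proof
    assume "vs ! i = vs ! l \<and> vs ! (Suc i mod length vs) = vs ! (Suc l mod length vs)"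
    then show ?thesis using assms(1) il by (simp add: nth_eq_iff_index_eq)
  next
    assume "vs ! i = vs ! (Suc l mod length vs) \<and> vs ! (Suc i mod length vs) = vs ! l"
    then have il': "i = Suc l mod length vs" "l = Suc i mod length vs"
      using nth_eq_iff_index_eq[OF assms(1), of i "Suc l mod length vs"]
        nth_eq_iff_index_eq[OF assms(1), of "Suc i mod length vs" l] il lt
      unfolding lessThan_iff by metis+
    have succ: "m' = Suc m \<or> m' = 0 \<and> Suc m = length vs"
      if "m' = Suc m mod length vs" "m \<in> {..<length vs}" for m m'
      using that by (cases "Suc m = length vs") simp_all
    from succ[OF il'(1) il(2)] succ[OF il'(2) il(1)] show ?thesis
      using assms(2) by presburger
  qed
qed

section \<open>Zero-sum cycles from degenerating sequences\<close>

lemma subring_of_real: "subring (range (of_real :: real \<Rightarrow> 'a::real_field))"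
proof -
  have "of_real a - of_real b \<in> range (of_real :: real \<Rightarrow> 'a)" for a b
    by (metis of_real_diff rangeI)
  moreover have "of_real a * of_real b \<in> range (of_real :: real \<Rightarrow> 'a)" for a b
    by (metis of_real_mult rangeI)
  moreover have "1 \<in> range (of_real :: real \<Rightarrow> 'a)" by (metis of_real_1 rangeI)
  ultimately show ?thesis unfolding subring_def by blast
qed

text \<open>An equation \<open>inverse z = p(z)\<close> would make \<open>z\<close> a root of the nonzero polynomial with value
  \<open>z p(z) - 1\<close>.\<close>

lemma inverse_not_in_adjoin:
  fixes z :: "'a::real_field"
  assumes "\<And>p. p \<noteq> 0 \<Longrightarrow> poly (map_poly of_real p) z \<noteq> 0"
  shows "inverse z \<notin> adjoin (range of_real) z"
proof
  assume "inverse z \<in> adjoin (range of_real) z"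
  then obtain p where p: "inverse z = poly p z" "\<And>i. coeff p i \<in> range of_real"
    unfolding adjoin_def by blast
  have "poly (map_poly of_real [:0, 1:]) z \<noteq> 0" by (intro assms) simp
  then have z: "z \<noteq> 0" by (simp add: map_poly_pCons)
  define q where "q = map_poly (inv (of_real :: real \<Rightarrow> 'a)) p"
  have "inj (of_real :: real \<Rightarrow> 'a)" by (simp add: inj_of_real)
  then have inv0: "inv of_real (0::'a) = (0::real)" by (metis inv_f_f of_real_0)
  have "map_poly of_real q = p"
    using p(2) by (intro poly_eqI) (simp add: q_def coeff_map_poly inv0 f_inv_into_f)
  then have "poly (map_poly of_real (pCons (- 1) q)) z = - 1 + z * inverse z"
    by (simp add: map_poly_pCons p(1))
  also have "\<dots> = 0" using z by simp
  finally show False using assms[of "pCons (- 1) q"] by simp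
qed

text \<open>The degeneration argument, for a sequence of real configurations with the same edge lengths
  in which the triangle \<open>{w, w', s}\<close> is fixed and the height of \<open>n\<close> never repeats.\<close>

lemma zero_sum_cycle_of_sequence:
  fixes x y z :: "nat \<Rightarrow> 'v \<Rightarrow> real" and L :: "'v set \<Rightarrow> real"
  assumes K: "triangular_polyhedron K"
    and faces: "{w, w', s} \<in> faces K" "{w, w', n} \<in> faces K" "s \<noteq> n"
    and len: "\<And>k u v. {u, v} \<in> edges K \<Longrightarrow>
      (x k u - x k v)\<^sup>2 + (y k u - y k v)\<^sup>2 + (z k u - z k v)\<^sup>2 = (L {u, v})\<^sup>2"
    and w: "\<And>k. x k w = 0" "\<And>k. y k w = 0" "\<And>k. z k w = 0"
    and w': "\<And>k. x k w' = d" "\<And>k. y k w' = 0" "\<And>k. z k w' = 0"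
    and s: "\<And>k. x k s = \<alpha>" "\<And>k. y k s = \<beta>" "\<And>k. z k s = 0" "\<beta> \<noteq> 0"
    and n: "\<And>k. x k n = \<gamma>" "inj (\<lambda>k. y k n)"
  shows "\<exists>C D. induced_cycle C D (vertices K) (edges K) \<and>
           {w, w'} \<in> D \<and> s \<notin> C \<and> n \<notin> C \<and>
           (\<exists>\<eta> :: 'v set \<Rightarrow> real. (\<forall>e\<in>D. \<eta> e \<in> {1, -1}) \<and> (\<Sum>e\<in>D. \<eta> e * L e) = 0)"
proof -
  define X where "X v = seq_class (\<lambda>k. x k v)" for v
  define Y where "Y v = seq_class (\<lambda>k. y k v)" for v
  define Z where "Z v = seq_class (\<lambda>k. z k v)" for v
  have lenF: "(X u - X v)\<^sup>2 + (Y u - Y v)\<^sup>2 + (Z u - Z v)\<^sup>2 = of_real ((L {u, v})\<^sup>2)"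
    if "{u, v} \<in> edges K" for u v
    unfolding X_def Y_def Z_def len[OF that, symmetric] seq_class_const[symmetric]
    by (simp add: seq_class_ring[symmetric] seq_class_power[symmetric] len[OF that])
  have wF: "X w = 0" "Y w = 0" "Z w = 0" and w'F: "X w' = of_real d" "Y w' = 0" "Z w' = 0"
    and sF: "X s = of_real \<alpha>" "Y s = of_real \<beta>" "Z s = 0" and nF: "X n = of_real \<gamma>"
    by (simp_all add: X_def Y_def Z_def w w' s n seq_class_const)
  define t where "t = inverse (Y n)"
  have t: "t = seq_class (\<lambda>k. inverse (y k n))" by (simp add: t_def Y_def seq_class_inverse)
  have "inj (\<lambda>k. inverse (y k n))" using n(2) by (simp add: inj_def)
  then have trans: "poly (map_poly of_real p) t \<noteq> 0" if "p \<noteq> 0" for p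
    using that unfolding t by (rule seq_class_transcendental)
  obtain R where R: "adjoin (range of_real) t \<subseteq> R" "Y n \<notin> R" "valuation_ring R"
    using valuation_ring_avoiding[OF subring_adjoin[OF subring_of_real], of "Y n" t]
      adjoin_self[OF subring_of_real, of t] inverse_not_in_adjoin[of t, OF trans]
    by (auto simp: t_def)
  interpret real_place R
    using R(1,3) subset_adjoin[OF subring_of_real, of t] by unfold_locales auto
  have Yn: "Y n \<noteq> 0" "t \<in> infinitesimals" using inverse_infinite[OF R(2)] by (auto simp: t_def)
  define j where "j = Z n / Y n"
  have "1 + j\<^sup>2 = ((Y n)\<^sup>2 + (Z n)\<^sup>2) * t\<^sup>2"
    using Yn(1) by (simp add: j_def t_def field_simps)
  also have "(Y n)\<^sup>2 + (Z n)\<^sup>2 = of_real ((L {w, n})\<^sup>2 - \<gamma>\<^sup>2)"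
    using lenF[OF face_of_triple(5)[OF K faces(2)]] wF nF by (simp add: algebra_simps)
  also have "of_real ((L {w, n})\<^sup>2 - \<gamma>\<^sup>2) * t\<^sup>2 \<in> infinitesimals"
    using m_mult(1)[OF of_real_in m_mult(1)[OF m_in_R Yn(2)], OF Yn(2)]
    by (simp only: power2_eq_square)
  finally have j2: "1 + j\<^sup>2 \<in> infinitesimals" .
  then have "(1 + j\<^sup>2) - 1 \<in> R" by (intro R_closed(1,4) m_in_R)
  then have "j\<^sup>2 \<in> R" by simp
  then have "j \<in> R" by (rule square_in_R)
  then interpret place_of_realization R X Y Z "edges K" j
    using j2 lenF of_real_in by unfold_locales (auto simp del: of_real_power)
  define A where "A = {v \<in> vertices K. on_plane v}"
  define B where "B = {v \<in> vertices K. towards v}"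
  have disj: "A \<inter> B = {}"
    by (auto simp: A_def B_def on_plane_def finite_at_def towards_def)
  have closed: "c \<in> A \<or> c \<in> B" if "a \<in> A" "b \<in> B" "{a, b, c} \<in> faces K" for a b c
  proof -
    note face = face_of_triple[OF K that(3)]
    have ab: "on_plane a" "towards b" using that by (auto simp: A_def B_def)
    show ?thesis
    proof (cases "finite_at c")
      case True
      have "on_plane c"
        using face(4,6) ab True by (intro finite_neighbour_on_plane[of a b c]) (auto simp: insert_commute)
      then show ?thesis using face(9) by (simp add: A_def)
    next
      case False
      have "towards c"
        using face(4-6) ab False by (intro infinite_neighbour_towards[of a b c]) (auto simp: on_plane_def)
      then show ?thesis using face(9) by (simp add: B_def)
    qed
  qed
  note V = face_of_triple(7-9)[OF K faces(1)] face_of_triple(9)[OF K faces(2)]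
  have "towards n"
    using R(2) m_mult(1)[OF of_real_in Yn(2), of \<gamma>]
    unfolding towards_def by (simp add: nF t_def m_zero divide_inverse j_def)
  then have nB: "n \<in> B" using V by (simp add: B_def)
  \<comment> \<open>The height \<open>\<beta>\<close> of \<open>s\<close> is a nonzero real, hence neither infinite nor infinitesimal.\<close>
  have sA: "s \<notin> A" and sB: "s \<notin> B"
    using s(4) of_real_in by (auto simp: A_def B_def on_plane_def towards_def sF of_real_infinitesimal_iff)
  have wA: "w \<in> A" "w' \<in> A"
    using V of_real_in by (auto simp: A_def on_plane_def finite_at_def wF w'F m_zero R_closed)
  have path: "(w, w') \<in> {(u, v). u \<in> A \<and> v \<in> A \<and> {u, v} \<in> edges K \<and> {u, v} \<noteq> {w, w'}}\<^sup>*"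
    by (rule path_along_mixed_strip[OF K disj closed faces(2) nB faces(1) sB faces(3) wA])
  have ww': "{w, w'} \<in> edges K" "w \<noteq> w'" using face_of_triple[OF K faces(1)] by auto
  have card2: "card e = 2" if "e \<in> edges K" for e using that by (simp add: edges_def)
  obtain vs where vs: "distinct vs" "length vs \<ge> 3" "set vs \<subseteq> A" "w \<in> set vs" "w' \<in> set vs"
    and D: "{e \<in> edges K. e \<subseteq> set vs} = {{vs ! i, vs ! (Suc i mod length vs)} | i. i < length vs}"
    by (rule induced_cycle_of_path[OF card2 ww' wA(1) path])
  define e where "e i = {vs ! i, vs ! (Suc i mod length vs)}" for i
  have e_edge: "e i \<in> edges K" if "i < length vs" for i
    using D that by (auto simp: e_def)
  have De: "{e \<in> edges K. e \<subseteq> set vs} = e ` {..<length vs}" unfolding D by (auto simp: e_def)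
  have inj: "inj_on e {..<length vs}"
    unfolding e_def by (rule cycle_edges_inj[OF vs(1,2)])
  have in_plane: "on_plane (vs ! i)" if "i < length vs" for i
    using vs(3) nth_mem[OF that] by (auto simp: A_def)
  have "\<exists>\<sigma>\<in>{1, -1::real}. X (vs ! i) - X (vs ! (Suc i mod length vs)) - of_real (\<sigma> * L (e i)) \<in> infinitesimals"
    if i: "i < length vs" for i
  proof -
    have "Suc i mod length vs < length vs" using vs(2) by (intro mod_less_divisor) linarith
    then show ?thesis
      using edge_on_plane_signed_length[OF in_plane[OF i] in_plane lenF] e_edge[OF i]
      unfolding e_def by blast
  qed
  then obtain \<sigma> where \<sigma>: "\<And>i. i < length vs \<Longrightarrow> \<sigma> i \<in> {1, -1::real}"
    "\<And>i. i < length vs \<Longrightarrow> X (vs ! i) - X (vs ! (Suc i mod length vs)) - of_real (\<sigma> i * L (e i)) \<in> infinitesimals"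
    by metis
  have "(\<Sum>i<length vs. X (vs ! i) - X (vs ! (Suc i mod length vs)) - of_real (\<sigma> i * L (e i)))
      = - of_real (\<Sum>i<length vs. \<sigma> i * L (e i))"
    using sum_cyclic_shift[of "\<lambda>i. X (vs ! i)" "length vs"] by (simp add: sum_subtractf)
  moreover have "(\<Sum>i<length vs. X (vs ! i) - X (vs ! (Suc i mod length vs)) - of_real (\<sigma> i * L (e i))) \<in> infinitesimals"
    using \<sigma>(2) by (intro m_sum) auto
  ultimately have "of_real (- (\<Sum>i<length vs. \<sigma> i * L (e i))) \<in> infinitesimals"
    by (simp only: of_real_minus)
  then have zero: "(\<Sum>i<length vs. \<sigma> i * L (e i)) = 0"
    unfolding of_real_infinitesimal_iff by simp
  define \<eta> where "\<eta> = \<sigma> \<circ> inv_into {..<length vs} e"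
  have \<eta>: "\<eta> (e i) = \<sigma> i" if "i < length vs" for i
    using inj that by (simp add: \<eta>_def)
  show ?thesis
  proof (intro exI conjI)
    show "induced_cycle (set vs) (e ` {..<length vs}) (vertices K) (edges K)"
      unfolding induced_cycle_def induced_subgraph_def cycle_graph_def
    proof (intro conjI exI[of _ vs])
      show "set vs \<subseteq> vertices K" using vs(3) by (auto simp: A_def)
      show "e ` {..<length vs} = {d \<in> edges K. d \<subseteq> set vs}" using De by simp
      show "e ` {..<length vs} = {{vs ! i, vs ! (Suc i mod length vs)} | i. i < length vs}"
        using De D by simp
    qed (use vs in auto)
    show "{w, w'} \<in> e ` {..<length vs}" using ww'(1) vs(4,5) unfolding De[symmetric] by simp
    show "s \<notin> set vs" "n \<notin> set vs" using vs(3) sA nB disj by auto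
    show "\<forall>d\<in>e ` {..<length vs}. \<eta> d \<in> {1, - 1}" using \<eta> \<sigma>(1) by auto
    show "(\<Sum>d\<in>e ` {..<length vs}. \<eta> d * L d) = 0"
      using zero by (simp add: sum.reindex[OF inj] \<eta>)
  qed
qed

section \<open>Coordinates relative to a moving triangle\<close>

text \<open>This is Lagrange's identity \<open>|z \<times> u|\<^sup>2 + (z \<bullet> u)\<^sup>2 = |z|\<^sup>2 |u|\<^sup>2\<close> for \<open>u = e \<times> e'\<close>.\<close>

lemma norm_in_frame:
  fixes e e' :: "real^3"
  assumes "norm e = 1" "norm e' = 1" "e \<bullet> e' = 0"
  shows "(norm z)\<^sup>2 = (z \<bullet> e)\<^sup>2 + (z \<bullet> e')\<^sup>2 + (z \<bullet> cross3 e e')\<^sup>2"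
proof -
  have "(norm (cross3 e e'))\<^sup>2 = 1" using norm_cross_dot[of e e'] assms by simp
  then have "(norm z)\<^sup>2 = (norm (cross3 z (cross3 e e')))\<^sup>2 + (z \<bullet> cross3 e e')\<^sup>2"
    using norm_cross_dot[of z "cross3 e e'"] by (simp add: power_mult_distrib)
  moreover have "(norm (cross3 z (cross3 e e')))\<^sup>2 = (z \<bullet> e)\<^sup>2 + (z \<bullet> e')\<^sup>2"
  proof -
    have "e \<bullet> e = 1" "e' \<bullet> e' = 1" "e' \<bullet> e = 0"
      using assms by (simp_all add: norm_eq_1 inner_commute)
    then show ?thesis
      unfolding Lagrange power2_norm_eq_inner
      using assms(3) by (simp add: inner_diff power2_eq_square)
  qed
  ultimately show ?thesis by simp
qed

lemma orth_part_sgn: "orth_part d x = x - (x \<bullet> sgn d) *\<^sub>R sgn d"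
  by (simp add: orth_part_def sgn_div_norm dot_square_norm power2_eq_square field_simps)

lemma orth_part_orthogonal: "orth_part d x \<bullet> sgn d = 0"
proof (cases "d = 0")
  case False
  then have "sgn d \<bullet> sgn d = 1" by (simp add: dot_square_norm norm_sgn)
  then show ?thesis by (simp add: orth_part_sgn inner_diff_left)
qed simp

lemma norm_orth_part: "d \<noteq> 0 \<Longrightarrow> (norm (orth_part d x))\<^sup>2 = (norm x)\<^sup>2 - (x \<bullet> sgn d)\<^sup>2"
proof -
  assume "d \<noteq> 0"
  then have "sgn d \<bullet> sgn d = 1" by (simp add: dot_square_norm norm_sgn)
  then show ?thesis
    unfolding orth_part_sgn power2_norm_eq_inner
    by (simp add: inner_diff power2_eq_square inner_commute)
qed

lemma orth_part_nonzero:
  assumes "\<not> collinear {p, q, a}"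
  shows "q - p \<noteq> 0" "orth_part (q - p) (a - p) \<noteq> 0"
proof -
  show "q - p \<noteq> 0" using assms by auto
  show "orth_part (q - p) (a - p) \<noteq> 0"
  proof
    assume "orth_part (q - p) (a - p) = 0"
    then have "a - p = (((a - p) \<bullet> (q - p)) / ((q - p) \<bullet> (q - p))) *\<^sub>R (q - p)"
      by (simp add: orth_part_def)
    then have "collinear {0, q - p, a - p}"
      unfolding collinear_lemma by blast
    then show False using assms collinear_3[of q p a] by (simp add: insert_commute)
  qed
qed

text \<open>By the law of cosines, the component along the axis of a triangle only depends on the side lengths.\<close>

lemma axial_coordinate:
  fixes d z :: "real^3"
  assumes "d \<noteq> 0"
  shows "z \<bullet> sgn d = ((norm z)\<^sup>2 + (norm d)\<^sup>2 - (norm (z - d))\<^sup>2) / (2 * norm d)"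
proof -
  have "(norm (z - d))\<^sup>2 = (norm z)\<^sup>2 + (norm d)\<^sup>2 - 2 * (z \<bullet> d)"
    by (simp add: power2_norm_eq_inner inner_diff inner_commute)
  then show ?thesis using assms by (simp add: sgn_div_norm field_simps)
qed

text \<open>For a triangle \<open>p, q, a\<close>, the numbers \<open>(v - p) \<bullet> sgn (q - p)\<close>, \<open>height p q a v\<close> and \<open>depth p q a v\<close>
  are the coordinates of \<open>v\<close> in the orthonormal frame with origin \<open>p\<close> whose first axis passes through
  \<open>q\<close> and whose first two axes span the plane of the triangle.\<close>

definition height :: "real^3 \<Rightarrow> real^3 \<Rightarrow> real^3 \<Rightarrow> real^3 \<Rightarrow> real" where
  "height p q a v = (v - p) \<bullet> sgn (orth_part (q - p) (a - p))"

definition depth :: "real^3 \<Rightarrow> real^3 \<Rightarrow> real^3 \<Rightarrow> real^3 \<Rightarrow> real" where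
  "depth p q a v = (v - p) \<bullet> cross3 (sgn (q - p)) (sgn (orth_part (q - p) (a - p)))"

lemma frame_coordinates:
  assumes nc: "\<not> collinear {p, q, a}"
  shows "(norm (u - v))\<^sup>2 = ((u - p) \<bullet> sgn (q - p) - (v - p) \<bullet> sgn (q - p))\<^sup>2
           + (height p q a u - height p q a v)\<^sup>2 + (depth p q a u - depth p q a v)\<^sup>2"
    and "height p q a q = 0" "depth p q a q = 0"
    and "height p q a a = norm (orth_part (q - p) (a - p))" "depth p q a a = 0"
proof -
  let ?d = "q - p" and ?o = "orth_part (q - p) (a - p)"
  note nz = orth_part_nonzero[OF nc]
  have orth: "sgn ?d \<bullet> sgn ?o = 0"
    using orth_part_orthogonal[of ?d "a - p"] by (simp add: sgn_div_norm inner_commute)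
  have unit: "norm (sgn ?d) = 1" "norm (sgn ?o) = 1" using nz by (simp_all add: norm_sgn)
  show "(norm (u - v))\<^sup>2 = ((u - p) \<bullet> sgn (q - p) - (v - p) \<bullet> sgn (q - p))\<^sup>2
           + (height p q a u - height p q a v)\<^sup>2 + (depth p q a u - depth p q a v)\<^sup>2"
    using norm_in_frame[OF unit orth, of "u - v"]
    by (simp add: height_def depth_def flip: inner_diff_left)
  have d: "?d = norm ?d *\<^sub>R sgn ?d" and o: "?o = norm ?o *\<^sub>R sgn ?o"
    using nz by (simp_all add: sgn_div_norm)
  show "height p q a q = 0" unfolding height_def by (subst d) (simp add: orth)
  show "depth p q a q = 0" unfolding depth_def by (subst d) (simp add: dot_cross_self)
  have a: "a - p = ((a - p) \<bullet> sgn ?d) *\<^sub>R sgn ?d + norm ?o *\<^sub>R sgn ?o"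
    using o by (simp add: orth_part_sgn)
  have "sgn ?o \<bullet> sgn ?o = 1" using unit(2) by (simp add: dot_square_norm)
  then show "height p q a a = norm ?o"
    unfolding height_def using arg_cong[OF a, of "\<lambda>x. x \<bullet> sgn ?o"] orth by (simp add: inner_add_left)
  show "depth p q a a = 0"
    unfolding depth_def
    using arg_cong[OF a, of "\<lambda>x. x \<bullet> cross3 (sgn ?d) (sgn ?o)"] by (simp add: inner_add_left dot_cross_self)
qed

text \<open>The vector from the axis to \<open>a\<close> is a positive multiple of the second vector of the frame.\<close>

lemma dihedral_angle_height:
  assumes "\<not> collinear {p, q, a}"
  shows "dihedral_angle p q a b = arccos (height p q a b / norm (orth_part (q - p) (b - p)))"
proof -
  let ?d = "q - p" and ?o = "orth_part (q - p) (a - p)" and ?b = "orth_part (q - p) (b - p)"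
  note nz = orth_part_nonzero[OF assms]
  have "?o \<bullet> ?b = ?o \<bullet> (b - p)"
    using orth_part_orthogonal[of ?d "a - p"] by (simp add: orth_part_sgn[of _ "b - p"] inner_diff_right)
  also have "\<dots> = norm ?o * height p q a b"
    using nz by (simp add: height_def sgn_div_norm inner_commute)
  finally show ?thesis using nz by (simp add: dihedral_angle_def vector_angle_def)
qed

text \<open>A connected set of reals with more than one point is infinite.\<close>

lemma infinite_range_of_nonconstant:
  fixes g :: "real \<Rightarrow> real"
  assumes "continuous_on {0..<1} g" "\<not> g constant_on {0..<1}"
  shows "\<exists>\<tau> :: nat \<Rightarrow> real. range \<tau> \<subseteq> {0..<1} \<and> inj (g \<circ> \<tau>)"
proof -
  have "connected (g ` {0..<1})"
    by (rule connected_continuous_image[OF assms(1)]) simp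
  moreover have "\<nexists>c. g ` {0..<1} = {c}" using assms(2) by (auto simp: constant_on_def)
  ultimately have "infinite (g ` {0..<1})" by (auto simp: connected_finite_iff_sing)
  then obtain h :: "nat \<Rightarrow> real" where h: "inj h" "range h \<subseteq> g ` {0..<1}"
    using infinite_countable_subset by blast
  define \<tau> where "\<tau> k = inv_into {0..<1} g (h k)" for k
  have \<tau>: "\<tau> k \<in> {0..<1}" "g (\<tau> k) = h k" for k
  proof -
    have "h k \<in> g ` {0..<1}" using h(2) by blast
    then show "\<tau> k \<in> {0..<1}" "g (\<tau> k) = h k"
      unfolding \<tau>_def by (rule inv_into_into, rule f_inv_into_f)
  qed
  have "g \<circ> \<tau> = h" using \<tau>(2) by (simp add: fun_eq_iff)
  then show ?thesis using \<tau>(1) h(1) by (intro exI[of _ \<tau>]) (auto simp del: atLeastLessThan_iff)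
qed

theorem theorem2p2:
  fixes K :: "'a set set"
    and \<rho> :: "'a \<Rightarrow> real^3"
    and f :: "real \<Rightarrow> 'a \<Rightarrow> real^3"
    and w\<^sub>1 w\<^sub>2 s n :: 'a
  assumes "triangular_polyhedron K"
    and "realization (vertices K) (edges K) \<rho>"
    and "is_flex (vertices K) (edges K) \<rho> f"
    and "{w\<^sub>1, w\<^sub>2} \<in> edges K"
    and "{w\<^sub>1, w\<^sub>2, s} \<in> faces K"
    and "{w\<^sub>1, w\<^sub>2, n} \<in> faces K"
    and "s \<noteq> n"
    and "\<forall>t\<in>{0..<1}. dihedral_angle_defined (f t w\<^sub>1) (f t w\<^sub>2) (f t s) (f t n)"
    and "\<not> (\<lambda>t. dihedral_angle (f t w\<^sub>1) (f t w\<^sub>2) (f t s) (f t n)) constant_on {0..<1}"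
  shows "\<exists>C D. induced_cycle C D (vertices K) (edges K) \<and>
           {w\<^sub>1, w\<^sub>2} \<in> D \<and> s \<notin> C \<and> n \<notin> C \<and>
           (\<exists>\<eta> :: 'a set \<Rightarrow> real. (\<forall>e\<in>D. \<eta> e \<in> {1, -1}) \<and>
              (\<Sum>e\<in>D. \<eta> e * edge_length \<rho> e) = 0)"
proof -
  let ?T = "{0..<1::real}" and ?L = "edge_length \<rho>"
  note S = face_of_triple[OF assms(1,5)] and N = face_of_triple[OF assms(1,6)]
  have len: "norm (f t u - f t v) = ?L {u, v}"
    if "t \<in> ?T" "{u, v} \<in> edges K" "u \<in> vertices K" "v \<in> vertices K" for t u v
  proof -
    have "edge_length (f t) {u, v} = edge_length (f 0) {u, v}"
      using assms(3) that unfolding is_flex_def by blast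
    moreover have "f 0 u = \<rho> u" "f 0 v = \<rho> v" using assms(3) that by (auto simp: is_flex_def)
    ultimately show ?thesis by (simp add: edge_length_pair)
  qed
  have nc: "\<not> collinear {f t w\<^sub>1, f t w\<^sub>2, f t s}" if "t \<in> ?T" for t
    using assms(8) that by (simp add: dihedral_angle_defined_def)
  have nz: "f t w\<^sub>2 - f t w\<^sub>1 \<noteq> 0" "orth_part (f t w\<^sub>2 - f t w\<^sub>1) (f t s - f t w\<^sub>1) \<noteq> 0" if "t \<in> ?T" for t
    using orth_part_nonzero[OF nc[OF that]] by auto
  have L12: "norm (f t w\<^sub>2 - f t w\<^sub>1) = ?L {w\<^sub>1, w\<^sub>2}" if "t \<in> ?T" for t
    using len[OF that S(4,7,8)] by (simp add: norm_minus_commute)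
  \<comment> \<open>The coordinate of a neighbour \<open>v\<close> of \<open>w\<^sub>1\<close> and \<open>w\<^sub>2\<close> along the axis, which is the same at all times.\<close>
  define c where "c v = ((?L {w\<^sub>1, v})\<^sup>2 + (?L {w\<^sub>1, w\<^sub>2})\<^sup>2 - (?L {w\<^sub>2, v})\<^sup>2) / (2 * ?L {w\<^sub>1, w\<^sub>2})" for v
  have axial: "(f t v - f t w\<^sub>1) \<bullet> sgn (f t w\<^sub>2 - f t w\<^sub>1) = c v"
    and orth: "norm (orth_part (f t w\<^sub>2 - f t w\<^sub>1) (f t v - f t w\<^sub>1)) = sqrt ((?L {w\<^sub>1, v})\<^sup>2 - (c v)\<^sup>2)"
    if t: "t \<in> ?T" and v: "{w\<^sub>1, v} \<in> edges K" "{w\<^sub>2, v} \<in> edges K" "v \<in> vertices K" for t v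
  proof -
    have 1: "norm (f t v - f t w\<^sub>1) = ?L {w\<^sub>1, v}" "norm (f t v - f t w\<^sub>2) = ?L {w\<^sub>2, v}"
      using len[OF t v(1) S(7) v(3)] len[OF t v(2) S(8) v(3)] by (simp_all add: norm_minus_commute)
    have "f t v - f t w\<^sub>1 - (f t w\<^sub>2 - f t w\<^sub>1) = f t v - f t w\<^sub>2" by simp
    then show *: "(f t v - f t w\<^sub>1) \<bullet> sgn (f t w\<^sub>2 - f t w\<^sub>1) = c v"
      using axial_coordinate[OF nz(1)[OF t], of "f t v - f t w\<^sub>1"] by (simp add: c_def 1 L12[OF t])
    show "norm (orth_part (f t w\<^sub>2 - f t w\<^sub>1) (f t v - f t w\<^sub>1)) = sqrt ((?L {w\<^sub>1, v})\<^sup>2 - (c v)\<^sup>2)"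
      using norm_orth_part[OF nz(1)[OF t], of "f t v - f t w\<^sub>1"] by (simp add: * 1 real_sqrt_unique)
  qed
  note axial_s = axial[OF _ S(5,6,9)] and orth_s = orth[OF _ S(5,6,9)]
  note axial_n = axial[OF _ N(5,6,9)] and orth_n = orth[OF _ N(5,6,9)]
  define \<beta> where "\<beta> = sqrt ((?L {w\<^sub>1, s})\<^sup>2 - (c s)\<^sup>2)"
  define x where "x t v = (f t v - f t w\<^sub>1) \<bullet> sgn (f t w\<^sub>2 - f t w\<^sub>1)" for t v
  define y where "y t v = height (f t w\<^sub>1) (f t w\<^sub>2) (f t s) (f t v)" for t v
  define z where "z t v = depth (f t w\<^sub>1) (f t w\<^sub>2) (f t s) (f t v)" for t v
  have cont: "continuous_on ?T (\<lambda>t. f t v)" if "v \<in> vertices K" for v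
    using assms(3) that by (simp add: is_flex_def)
  have "continuous_on ?T (\<lambda>t. y t n)"
    unfolding y_def height_def sgn_div_norm orth_part_def
    by (intro continuous_intros cont S(7-9) N(9))
      (use nz in \<open>auto simp: orth_part_def\<close>)
  \<comment> \<open>The distance of \<open>n\<close> to the axis is constant, so a constant height would mean a constant dihedral angle.\<close>
  moreover have "\<not> (\<lambda>t. y t n) constant_on ?T"
  proof
    assume "(\<lambda>t. y t n) constant_on ?T"
    then obtain h where h: "\<And>t. t \<in> ?T \<Longrightarrow> y t n = h" unfolding constant_on_def by blast
    have "dihedral_angle (f t w\<^sub>1) (f t w\<^sub>2) (f t s) (f t n)
        = arccos (h / sqrt ((?L {w\<^sub>1, n})\<^sup>2 - (c n)\<^sup>2))" if "t \<in> ?T" for t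
      using dihedral_angle_height[OF nc[OF that]] h[OF that] orth_n[OF that] by (simp add: y_def)
    then show False using assms(9) unfolding constant_on_def by blast
  qed
  ultimately obtain \<tau> :: "nat \<Rightarrow> real" where \<tau>: "range \<tau> \<subseteq> ?T" "inj ((\<lambda>t. y t n) \<circ> \<tau>)"
    using infinite_range_of_nonconstant by blast
  have T: "\<tau> k \<in> ?T" for k using \<tau>(1) by blast
  show ?thesis
  proof (rule zero_sum_cycle_of_sequence[OF assms(1,5,6,7), where x = "\<lambda>k. x (\<tau> k)"
        and y = "\<lambda>k. y (\<tau> k)" and z = "\<lambda>k. z (\<tau> k)" and d = "?L {w\<^sub>1, w\<^sub>2}"
        and \<alpha> = "c s" and \<beta> = \<beta> and \<gamma> = "c n"])
    fix k
    note fr = frame_coordinates[OF nc[OF T[of k]]]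
    show "(x (\<tau> k) u - x (\<tau> k) v)\<^sup>2 + (y (\<tau> k) u - y (\<tau> k) v)\<^sup>2 + (z (\<tau> k) u - z (\<tau> k) v)\<^sup>2 = (?L {u, v})\<^sup>2"
      if "{u, v} \<in> edges K" for u v
    proof -
      have "u \<in> vertices K" "v \<in> vertices K"
        using assms(1) that
        unfolding triangular_polyhedron_def abstract_simplicial_complex_def edges_def vertices_def
        by auto
      then show ?thesis
        using len[OF T[of k] that] fr(1)[of "f (\<tau> k) u" "f (\<tau> k) v"] by (simp add: x_def y_def z_def)
    qed
    show "x (\<tau> k) w\<^sub>1 = 0" "y (\<tau> k) w\<^sub>1 = 0" "z (\<tau> k) w\<^sub>1 = 0"
      by (simp_all add: x_def y_def z_def height_def depth_def)
    show "x (\<tau> k) w\<^sub>2 = ?L {w\<^sub>1, w\<^sub>2}"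
      using L12[OF T] axial_coordinate[OF nz(1)[OF T]] nz(1)[OF T, of k]
      by (simp add: x_def power2_eq_square field_simps)
    show "y (\<tau> k) w\<^sub>2 = 0" "z (\<tau> k) w\<^sub>2 = 0" by (simp_all add: y_def z_def fr)
    show "x (\<tau> k) s = c s" "x (\<tau> k) n = c n" by (simp_all add: x_def axial_s[OF T] axial_n[OF T])
    show "y (\<tau> k) s = \<beta>" by (simp add: y_def fr orth_s[OF T] \<beta>_def)
    show "z (\<tau> k) s = 0" by (simp add: z_def fr)
    show "\<beta> \<noteq> 0" unfolding \<beta>_def using orth_s[OF T] nz(2)[OF T] by (metis norm_eq_zero)
    show "inj (\<lambda>k. y (\<tau> k) n)" using \<tau>(2) by (simp add: comp_def)
  qed
qed

end
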